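(* Let a neutral-type system (NDS) be given by constant matrices $A_0,B_1,B_2,C_{10},C_{20},D_{kl}$, $A_i,B_{ki},C_{ki},D_{kli},E_i,E_{1i},E_{2i}$ and bounded measurable matrix-valued functions $A_{di},B_{kdi},C_{kdi},D_{kldi},E_{di},E_{1di},E_{2di}$ on $[-\tau_i,0]$ ($k,l\in\{1,2\}$, $i=1,\dots,K$), with delays $0<\tau_1<\dots<\tau_K$. Consider the DDF with the same $A_0,B_1,B_2,D_{11},D_{12},D_{21},D_{22}$, with $C_1=C_{10}$, $C_2=C_{20}$, with $n_v=n+q+r$ and $p_i=2n+m+p$, and with $$D_{rvi}=\begin{bmatrix}0&0&0 \\ 0&0&0 \\ 0&0&0 \\ I_n&0&0\end{bmatrix},\quad \begin{bmatrix}C_{ri}&B_{r1i}&B_{r2i}\end{bmatrix}=\begin{bmatrix}I_n & 0& 0 \\ 0&I_m&0 \\ 0&0&I_p \\ A_0 & B_1 & B_2\end{bmatrix},\quad \begin{bmatrix}B_v \\ D_{1v} \\ D_{2v}\end{bmatrix}=I_{n+q+r},$$ $$C_{vi}= \begin{bmatrix}A_i & B_{1i} & B_{2i}& E_i \\ C_{1i}& D_{11i} & D_{12i} & E_{1i} \\ C_{2i} & D_{21i} & D_{22i}&E_{2i}\end{bmatrix},\quad C_{vdi}(s)=\begin{bmatrix}A_{di}(s) & B_{1di}(s) &B_{2di}(s)& E_{di}(s) \\ C_{1di}(s) & D_{11di}(s) & D_{12di}(s)& E_{1di}(s) \\ C_{2di}(s) &D_{21di}(s) & D_{22di}(s)&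 E_{2di}(s)\end{bmatrix}.$$ Let $w\in W^{1,2}[0,\infty)^m$ and $u\in W^{1,2}[0,\infty)^p$ with $w(t)=0,u(t)=0$ for $t\le0$. Let $x:\mathbb{R}\to\mathbb{R}^n$ with $x(t)=0$ for $t\le0$, $z:[0,\infty)\to\mathbb{R}^q$ and $y:[0,\infty)\to\mathbb{R}^r$ be functions. Then $x,y,z$ satisfy the NDS for the given $u,w$ if and only if $x|_{[0,\infty)},y,z,v,r_i$ satisfy the DDF for the given $u,w$ with zero initial conditions ($x(0)=0$ and $r_{i0}=0$ for all $i$), where $$r_i(t)=\begin{bmatrix}x(t) \\ w(t) \\ u(t) \\ \dot x(t)\end{bmatrix},\qquad i=1,\dots,K,$$ and $$v(t)=\sum_{i=1}^K \begin{bmatrix}A_i & B_{1i} & B_{2i}& E_i \\ C_{1i}& D_{11i} & D_{12i} & E_{1i} \\ C_{2i} & D_{21i} & D_{22i}&E_{2i}\end{bmatrix}\begin{bmatrix}x(t-\tau_i) \\ w(t-\tau_i) \\ u(t-\tau_i) \\ \dot x(t-\tau_i)\end{bmatrix}+\sum_{i=1}^K \int_{-\tau_i}^0\begin{bmatrix}A_{di}(s) & B_{1di}(s) &B_{2di}(s)& E_{di}(s) \\ C_{1di}(s) & D_{11di}(s) & D_{12di}(s)& E_{1di}(s) \\ C_{2di}(s) &D_{21di}(s) & D_{22di}(s)& E_{2di}(s)\end{bmatrix} \begin{bmatrix}x(t+s) \\ w(t+s) \\ u(t+s) \\ \dot x(t+s)\end{bmatrix}ds.$$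
   Context: All functions in $W^{1,2}$ are identified with their absolutely continuous representatives. The inputs $w,u$ are extended by $0$ to negative times. The derivative $\dot x(0)$ means the right derivative at $0$, and $\dot x(t)=0$ for $t<0$. Signal dimensions: $x(t)\in\mathbb{R}^n$, $w(t)\in\mathbb{R}^m$, $u(t)\in\mathbb{R}^p$, $z(t)\in\mathbb{R}^q$, $y(t)\in\mathbb{R}^r$; matrix dimensions are the compatible ones. **NDS.** For given $u,w$, functions $x,z,y$ (with $x(t)=0$ for $t\le 0$) satisfy the NDS if $x$ is differentiable on $[0,\infty)$ (from the right at $0$), $\dot x$ is locally square integrable, and for all $t\ge0$ $$\begin{bmatrix}\dot x(t) \\ z(t) \\ y(t)\end{bmatrix}=\begin{bmatrix}A_0 & B_1 & B_2 \\ C_{10} & D_{11} &D_{12} \\ C_{20} & D_{21} &D_{22}\end{bmatrix}\begin{bmatrix}x(t) \\ w(t) \\ u(t)\end{bmatrix}+\sum_{i=1}^K \begin{bmatrix}A_i & B_{1i} & B_{2i}& E_i \\ C_{1i}& D_{11i} & D_{12i} & E_{1i} \\ C_{2i} & D_{21i} & D_{22i}&E_{2i}\end{bmatrix} \begin{bmatrix}x(t-\tau_i) \\ w(t-\tau_i) \\ u(t-\tau_i) \\ \dot x(t-\tau_i)\end{bmatrix}+\sum_{i=1}^K \int_{-\tau_i}^0\begin{bmatrix}A_{di}(s) & B_{1di}(s) &B_{2di}(s)& E_{di}(s) \\ C_{1di}(s) & D_{11di}(s) & D_{12di}(s)& E_{1di}(s) \\ C_{2di}(s) &D_{21di}(s)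 & D_{22di}(s)& E_{2di}(s)\end{bmatrix} \begin{bmatrix}x(t+s) \\ w(t+s) \\ u(t+s) \\ \dot x(t+s)\end{bmatrix}ds.$$ **DDF.** A DDF is given by matrices $A_0,B_k,C_k,D_{kl},B_v,D_{kv},C_{ri},B_{rki},D_{rvi},C_{vi}$ and bounded functions $C_{vdi}$. For given $u,w$ and initial conditions $\xi_0\in\mathbb{R}^n$, $r_{i0}\in W^{1,2}[-\tau_i,0]^{p_i}$ satisfying the sewing condition $$r_{i0}(0)=C_{ri}\xi_0+D_{rvi}\Big(\sum_{j=1}^K C_{vj} r_{j0}(-\tau_j)+\sum_{j=1}^K \int_{-\tau_j}^0C_{vdj}(s) r_{j0}(s)ds\Big),\quad i=1,\dots,K,$$ functions $x:[0,\infty)\to\mathbb{R}^n$, $z:[0,\infty)\to\mathbb{R}^q$, $y:[0,\infty)\to\mathbb{R}^r$, $r_i:[-\tau_i,\infty)\to\mathbb{R}^{p_i}$, $v:[0,\infty)\to\mathbb{R}^{n_v}$ satisfy the DDF if $x$ is differentiable on $[0,\infty)$, $x(0)=\xi_0$, $r_i(s)=r_{i0}(s)$ for $s\in[-\tau_i,0]$, $r_i(t+\cdot)\in W^{1,2}[-\tau_i,0]^{p_i}$ for all $t\ge 0$ and all $i$, and for all $t\ge0$, $i=1,\dots,K$, $$\begin{bmatrix}\dot x(t) \\ z(t) \\ y(t) \\ r_i(t)\end{bmatrix}=\begin{bmatrix}A_0 & B_1& B_2 \\ C_1 &D_{11}&D_{12} \\ C_2&D_{21}&D_{22} \\ C_{ri}&B_{r1i}&B_{r2i}\end{bmatrix}\begin{bmatrix}x(t)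 \\ w(t) \\ u(t)\end{bmatrix}+\begin{bmatrix}B_v \\ D_{1v} \\ D_{2v} \\ D_{rvi}\end{bmatrix} v(t),$$ $$v(t)=\sum_{i=1}^K C_{vi} r_i(t-\tau_i)+\sum_{i=1}^K \int_{-\tau_i}^0C_{vdi}(s) r_i(t+s)ds.$$ *)

theory Defs
  imports "HOL-Analysis.Analysis"
begin

text \<open>
  Block objects are indexed by sum types. A matrix is a vector of rows, so one vertical
  stacking operation serves both column vectors and matrices.
\<close>

definition stack :: "'a^'i \<Rightarrow> 'a^'j \<Rightarrow> 'a^('i + 'j)"  (infixr \<open>\<sslash>\<close> 64) where
  "a \<sslash> b = (\<chi> k. case k of Inl i \<Rightarrow> a $ i | Inr j \<Rightarrow> b $ j)"

definition beside :: "'a^'i^'k \<Rightarrow> 'a^'j^'k \<Rightarrow> 'a^('i + 'j)^'k"  (infixr \<open>\<bbar>\<close> 66) where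
  "A \<bbar> B = (\<chi> k. A $ k \<sslash> B $ k)"

definition square_integrable_on :: "(real \<Rightarrow> 'a::euclidean_space) \<Rightarrow> real set \<Rightarrow> bool"
    (infix \<open>square'_integrable'_on\<close> 46) where
  "f square_integrable_on S \<longleftrightarrow>
     set_borel_measurable lebesgue S f \<and> set_integrable lebesgue S (\<lambda>t. (norm (f t))\<^sup>2)"

text \<open>
  \<open>W12 S f\<close> for an interval \<open>S\<close>: the function itself (not merely its class modulo null sets) is
  the absolutely continuous representative of an element of the Sobolev space, i.e. it is square
  integrable and an indefinite Lebesgue integral of a square integrable function.
\<close>

definition W12 :: "real set \<Rightarrow> (real \<Rightarrow> 'a::euclidean_space) \<Rightarrow> bool" where
  "W12 S f \<longleftrightarrow> f square_integrable_on S \<and>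
     (\<exists>g. g square_integrable_on S \<and>
          (\<forall>a\<in>S. \<forall>b\<in>S. a \<le> b \<longrightarrow> f b - f a = (LINT t:{a..b}|lebesgue. g t)))"

definition bounded_measurable_on :: "(real \<Rightarrow> 'a::euclidean_space) \<Rightarrow> real set \<Rightarrow> bool" where
  "bounded_measurable_on f S \<longleftrightarrow> bounded (f ` S) \<and> set_borel_measurable lebesgue S f"

text \<open>The derivative on \<open>[0,\<infinity>)\<close> (from the right at \<open>0\<close>), extended by \<open>0\<close> to negative times.\<close>

definition tderiv :: "(real \<Rightarrow> 'a::real_normed_vector) \<Rightarrow> real \<Rightarrow> 'a" where
  "tderiv x t = (if t < 0 then 0 else vector_derivative x (at t within {0..}))"

definition delays :: "nat \<Rightarrow> (nat \<Rightarrow> real) \<Rightarrow> bool" where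
  "delays K \<tau> \<longleftrightarrow> 1 \<le> K \<and> (\<forall>i\<in>{1..K}. 0 < \<tau> i) \<and> strict_mono_on {1..K} \<tau>"

text \<open>
  State \<open>x\<close> in dimension \<open>'n\<close>, inputs \<open>w\<close> in \<open>'m\<close> and \<open>u\<close> in \<open>'p\<close>, outputs \<open>z\<close> in \<open>'q\<close> and \<open>y\<close> in
  \<open>'r\<close>. Fields ending in \<open>i\<close> are indexed by the delay number, fields ending in \<open>di\<close> by the delay
  number and by \<open>s \<in> [-\<tau>\<^sub>i, 0]\<close>.
\<close>

record ('n::finite, 'm::finite, 'p::finite, 'q::finite, 'r::finite) nds =
  A0 :: "real^'n^'n"    B1 :: "real^'m^'n"    B2 :: "real^'p^'n"
  C10 :: "real^'n^'q"   D11 :: "real^'m^'q"   D12 :: "real^'p^'q"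
  C20 :: "real^'n^'r"   D21 :: "real^'m^'r"   D22 :: "real^'p^'r"
  Ai :: "nat \<Rightarrow> real^'n^'n"    B1i :: "nat \<Rightarrow> real^'m^'n"
  B2i :: "nat \<Rightarrow> real^'p^'n"   Ei :: "nat \<Rightarrow> real^'n^'n"
  C1i :: "nat \<Rightarrow> real^'n^'q"   D11i :: "nat \<Rightarrow> real^'m^'q"
  D12i :: "nat \<Rightarrow> real^'p^'q"  E1i :: "nat \<Rightarrow> real^'n^'q"
  C2i :: "nat \<Rightarrow> real^'n^'r"   D21i :: "nat \<Rightarrow> real^'m^'r"
  D22i :: "nat \<Rightarrow> real^'p^'r"  E2i :: "nat \<Rightarrow> real^'n^'r"
  Adi :: "nat \<Rightarrow> real \<Rightarrow> real^'n^'n"    B1di :: "nat \<Rightarrow> real \<Rightarrow> real^'m^'n"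
  B2di :: "nat \<Rightarrow> real \<Rightarrow> real^'p^'n"   Edi :: "nat \<Rightarrow> real \<Rightarrow> real^'n^'n"
  C1di :: "nat \<Rightarrow> real \<Rightarrow> real^'n^'q"   D11di :: "nat \<Rightarrow> real \<Rightarrow> real^'m^'q"
  D12di :: "nat \<Rightarrow> real \<Rightarrow> real^'p^'q"  E1di :: "nat \<Rightarrow> real \<Rightarrow> real^'n^'q"
  C2di :: "nat \<Rightarrow> real \<Rightarrow> real^'n^'r"   D21di :: "nat \<Rightarrow> real \<Rightarrow> real^'m^'r"
  D22di :: "nat \<Rightarrow> real \<Rightarrow> real^'p^'r"  E2di :: "nat \<Rightarrow> real \<Rightarrow> real^'n^'r"

definition nds_bounded_measurable ::
  "nat \<Rightarrow> (nat \<Rightarrow> real) \<Rightarrow> ('n::finite, 'm::finite, 'p::finite, 'q::finite, 'r::finite) nds \<Rightarrow> bool"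
where
  "nds_bounded_measurable K \<tau> N \<longleftrightarrow> (\<forall>i\<in>{1..K}.
     bounded_measurable_on (Adi N i) {-\<tau> i..0} \<and>
     bounded_measurable_on (B1di N i) {-\<tau> i..0} \<and>
     bounded_measurable_on (B2di N i) {-\<tau> i..0} \<and>
     bounded_measurable_on (Edi N i) {-\<tau> i..0} \<and>
     bounded_measurable_on (C1di N i) {-\<tau> i..0} \<and>
     bounded_measurable_on (D11di N i) {-\<tau> i..0} \<and>
     bounded_measurable_on (D12di N i) {-\<tau> i..0} \<and>
     bounded_measurable_on (E1di N i) {-\<tau> i..0} \<and>
     bounded_measurable_on (C2di N i) {-\<tau> i..0} \<and>
     bounded_measurable_on (D21di N i) {-\<tau> i..0} \<and>
     bounded_measurable_on (D22di N i) {-\<tau> i..0} \<and>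
     bounded_measurable_on (E2di N i) {-\<tau> i..0})"

definition nds_direct ::
  "('n::finite, 'm::finite, 'p::finite, 'q::finite, 'r::finite) nds
   \<Rightarrow> real^('n + 'm + 'p)^('n + 'q + 'r)"
where
  "nds_direct N =
     (A0 N  \<bbar> B1 N  \<bbar> B2 N)  \<sslash>
     (C10 N \<bbar> D11 N \<bbar> D12 N) \<sslash>
     (C20 N \<bbar> D21 N \<bbar> D22 N)"

definition nds_delayed ::
  "('n::finite, 'm::finite, 'p::finite, 'q::finite, 'r::finite) nds
   \<Rightarrow> nat \<Rightarrow> real^('n + 'm + 'p + 'n)^('n + 'q + 'r)"
where
  "nds_delayed N i =
     (Ai N i  \<bbar> B1i N i  \<bbar> B2i N i  \<bbar> Ei N i)  \<sslash>
     (C1i N i \<bbar> D11i N i \<bbar> D12i N i \<bbar> E1i N i) \<sslash>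
     (C2i N i \<bbar> D21i N i \<bbar> D22i N i \<bbar> E2i N i)"

definition nds_distributed ::
  "('n::finite, 'm::finite, 'p::finite, 'q::finite, 'r::finite) nds
   \<Rightarrow> nat \<Rightarrow> real \<Rightarrow> real^('n + 'm + 'p + 'n)^('n + 'q + 'r)"
where
  "nds_distributed N i s =
     (Adi N i s  \<bbar> B1di N i s  \<bbar> B2di N i s  \<bbar> Edi N i s)  \<sslash>
     (C1di N i s \<bbar> D11di N i s \<bbar> D12di N i s \<bbar> E1di N i s) \<sslash>
     (C2di N i s \<bbar> D21di N i s \<bbar> D22di N i s \<bbar> E2di N i s)"

text \<open>
  Inputs are functions on the whole real line; the extension by \<open>0\<close> to negative times is a
  hypothesis on them. The outputs \<open>z\<close>, \<open>y\<close> matter only through their values on \<open>[0,\<infinity>)\<close>.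
\<close>

definition nds_column ::
  "(real \<Rightarrow> real^'n) \<Rightarrow> (real \<Rightarrow> real^'m) \<Rightarrow> (real \<Rightarrow> real^'p) \<Rightarrow> real \<Rightarrow> real^('n + 'm + 'p + 'n)"
where
  "nds_column x w u t = x t \<sslash> w t \<sslash> u t \<sslash> tderiv x t"

definition nds_memory ::
  "nat \<Rightarrow> (nat \<Rightarrow> real) \<Rightarrow> ('n::finite, 'm::finite, 'p::finite, 'q::finite, 'r::finite) nds
   \<Rightarrow> (real \<Rightarrow> real^'m) \<Rightarrow> (real \<Rightarrow> real^'p) \<Rightarrow> (real \<Rightarrow> real^'n) \<Rightarrow> real \<Rightarrow> real^('n + 'q + 'r)"
where
  "nds_memory K \<tau> N w u x t =
     (\<Sum>i=1..K. nds_delayed N i *v nds_column x w u (t - \<tau> i)) +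
     (\<Sum>i=1..K. LINT s:{-\<tau> i..0}|lebesgue. nds_distributed N i s *v nds_column x w u (t + s))"

definition satisfies_nds ::
  "nat \<Rightarrow> (nat \<Rightarrow> real) \<Rightarrow> ('n::finite, 'm::finite, 'p::finite, 'q::finite, 'r::finite) nds
   \<Rightarrow> (real \<Rightarrow> real^'m) \<Rightarrow> (real \<Rightarrow> real^'p)
   \<Rightarrow> (real \<Rightarrow> real^'n) \<Rightarrow> (real \<Rightarrow> real^'q) \<Rightarrow> (real \<Rightarrow> real^'r) \<Rightarrow> bool"
where
  "satisfies_nds K \<tau> N w u x z y \<longleftrightarrow>
     (\<forall>t\<le>0. x t = 0) \<and>
     x differentiable_on {0..} \<and>
     (\<forall>T\<ge>0. tderiv x square_integrable_on {0..T}) \<and>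
     (\<forall>t\<ge>0. tderiv x t \<sslash> z t \<sslash> y t =
        nds_direct N *v (x t \<sslash> w t \<sslash> u t) + nds_memory K \<tau> N w u x t)"

text \<open>
  The signals \<open>r\<^sub>i\<close> share one index type \<open>'c\<close>; signals of different dimensions are covered
  by padding with zero rows and columns.
\<close>

record ('n::finite, 'm::finite, 'p::finite, 'q::finite, 'r::finite, 'v::finite, 'c::finite) ddf =
  A0 :: "real^'n^'n"   B1 :: "real^'m^'n"    B2 :: "real^'p^'n"    Bv :: "real^'v^'n"
  C1 :: "real^'n^'q"   D11 :: "real^'m^'q"   D12 :: "real^'p^'q"   D1v :: "real^'v^'q"
  C2 :: "real^'n^'r"   D21 :: "real^'m^'r"   D22 :: "real^'p^'r"   D2v :: "real^'v^'r"
  Cri :: "nat \<Rightarrow> real^'n^'c"    Br1i :: "nat \<Rightarrow> real^'m^'c"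
  Br2i :: "nat \<Rightarrow> real^'p^'c"   Drvi :: "nat \<Rightarrow> real^'v^'c"
  Cvi :: "nat \<Rightarrow> real^'c^'v"
  Cvdi :: "nat \<Rightarrow> real \<Rightarrow> real^'c^'v"

definition ddf_memory ::
  "nat \<Rightarrow> (nat \<Rightarrow> real) \<Rightarrow>
   ('n::finite, 'm::finite, 'p::finite, 'q::finite, 'r::finite, 'v::finite, 'c::finite) ddf
   \<Rightarrow> (nat \<Rightarrow> real \<Rightarrow> real^'c) \<Rightarrow> real \<Rightarrow> real^'v"
where
  "ddf_memory K \<tau> D r t =
     (\<Sum>i=1..K. Cvi D i *v r i (t - \<tau> i)) +
     (\<Sum>i=1..K. LINT s:{-\<tau> i..0}|lebesgue. Cvdi D i s *v r i (t + s))"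

text \<open>The last conjunct is the sewing condition: at time \<open>0\<close> the memory term involves initial data only.\<close>

definition ddf_initial ::
  "nat \<Rightarrow> (nat \<Rightarrow> real) \<Rightarrow>
   ('n::finite, 'm::finite, 'p::finite, 'q::finite, 'r::finite, 'v::finite, 'c::finite) ddf
   \<Rightarrow> real^'n \<Rightarrow> (nat \<Rightarrow> real \<Rightarrow> real^'c) \<Rightarrow> bool"
where
  "ddf_initial K \<tau> D \<xi>0 r0 \<longleftrightarrow>
     (\<forall>i\<in>{1..K}. W12 {-\<tau> i..0} (r0 i)) \<and>
     (\<forall>i\<in>{1..K}. r0 i 0 = Cri D i *v \<xi>0 + Drvi D i *v ddf_memory K \<tau> D r0 0)"

text \<open>
  The functions \<open>x\<close>, \<open>z\<close>, \<open>y\<close>, \<open>v\<close> matter only through their values on \<open>[0,\<infinity>)\<close>, and \<open>r i\<close>, \<open>r0 i\<close>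
  only through their values on \<open>[-\<tau>\<^sub>i,\<infinity>)\<close> and \<open>[-\<tau>\<^sub>i,0]\<close>.
\<close>

definition satisfies_ddf ::
  "nat \<Rightarrow> (nat \<Rightarrow> real) \<Rightarrow>
   ('n::finite, 'm::finite, 'p::finite, 'q::finite, 'r::finite, 'v::finite, 'c::finite) ddf
   \<Rightarrow> (real \<Rightarrow> real^'m) \<Rightarrow> (real \<Rightarrow> real^'p)
   \<Rightarrow> real^'n \<Rightarrow> (nat \<Rightarrow> real \<Rightarrow> real^'c)
   \<Rightarrow> (real \<Rightarrow> real^'n) \<Rightarrow> (real \<Rightarrow> real^'q) \<Rightarrow> (real \<Rightarrow> real^'r)
   \<Rightarrow> (real \<Rightarrow> real^'v) \<Rightarrow> (nat \<Rightarrow> real \<Rightarrow> real^'c) \<Rightarrow> bool"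
where
  "satisfies_ddf K \<tau> D w u \<xi>0 r0 x z y v r \<longleftrightarrow>
     (\<forall>i\<in>{1..K}. bounded_measurable_on (Cvdi D i) {-\<tau> i..0}) \<and>
     ddf_initial K \<tau> D \<xi>0 r0 \<and>
     x differentiable_on {0..} \<and>
     x 0 = \<xi>0 \<and>
     (\<forall>i\<in>{1..K}. \<forall>s\<in>{-\<tau> i..0}. r i s = r0 i s) \<and>
     (\<forall>i\<in>{1..K}. \<forall>t\<ge>0. W12 {-\<tau> i..0} (\<lambda>s. r i (t + s))) \<and>
     (\<forall>t\<ge>0. \<forall>i\<in>{1..K}. tderiv x t \<sslash> z t \<sslash> y t \<sslash> r i t =
        ((ddf.A0 D \<bbar> ddf.B1 D \<bbar> ddf.B2 D) \<sslash>
         (ddf.C1 D \<bbar> ddf.D11 D \<bbar> ddf.D12 D) \<sslash>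
         (ddf.C2 D \<bbar> ddf.D21 D \<bbar> ddf.D22 D) \<sslash>
         (Cri D i \<bbar> Br1i D i \<bbar> Br2i D i)) *v (x t \<sslash> w t \<sslash> u t) +
        (Bv D \<sslash> D1v D \<sslash> D2v D \<sslash> Drvi D i) *v v t) \<and>
     (\<forall>t\<ge>0. v t = ddf_memory K \<tau> D r t)"

definition ddf_of_nds ::
  "('n::finite, 'm::finite, 'p::finite, 'q::finite, 'r::finite) nds
   \<Rightarrow> ('n, 'm, 'p, 'q, 'r, 'n + 'q + 'r, 'n + 'm + 'p + 'n) ddf"
where
  "ddf_of_nds N =
    \<lparr>ddf.A0 = nds.A0 N, B1 = nds.B1 N, B2 = nds.B2 N, Bv = mat 1 \<bbar> 0 \<bbar> 0,
     C1 = nds.C10 N, D11 = nds.D11 N, D12 = nds.D12 N, D1v = 0 \<bbar> mat 1 \<bbar> 0,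
     C2 = nds.C20 N, D21 = nds.D21 N, D22 = nds.D22 N, D2v = 0 \<bbar> 0 \<bbar> mat 1,
     Cri = (\<lambda>i. mat 1 \<sslash> 0 \<sslash> 0 \<sslash> nds.A0 N),
     Br1i = (\<lambda>i. 0 \<sslash> mat 1 \<sslash> 0 \<sslash> nds.B1 N),
     Br2i = (\<lambda>i. 0 \<sslash> 0 \<sslash> mat 1 \<sslash> nds.B2 N),
     Drvi = (\<lambda>i. (0 \<bbar> 0 \<bbar> 0) \<sslash> (0 \<bbar> 0 \<bbar> 0) \<sslash> (0 \<bbar> 0 \<bbar> 0) \<sslash> (mat 1 \<bbar> 0 \<bbar> 0)),
     Cvi = nds_delayed N,
     Cvdi = nds_distributed N\<rparr>"

lemma ddf_of_nds_output_block:
  "Bv (ddf_of_nds N) \<sslash> D1v (ddf_of_nds N) \<sslash> D2v (ddf_of_nds N) = mat 1"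
  by (auto simp: ddf_of_nds_def vec_eq_iff stack_def beside_def mat_def split: sum.splits)

lemma ddf_of_nds_channel_block:
  "Cri (ddf_of_nds N) i \<bbar> Br1i (ddf_of_nds N) i \<bbar> Br2i (ddf_of_nds N) i =
     (mat 1 \<bbar> 0 \<bbar> 0) \<sslash> (0 \<bbar> mat 1 \<bbar> 0) \<sslash> (0 \<bbar> 0 \<bbar> mat 1) \<sslash>
     (nds.A0 N \<bbar> nds.B1 N \<bbar> nds.B2 N)"
  by (auto simp: ddf_of_nds_def vec_eq_iff stack_def beside_def split: sum.splits)

end

theory Submission
  imports Defs
begin

text \<open>
  Only one point is not bookkeeping: a solution of the NDS has a merely locally square integrable
  \<open>x'\<close>, whereas the DDF requires \<open>r = (x, w, u, x')\<close> to be absolutely continuous with locally square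
  integrable derivative. The fourth row of the DDF reads \<open>r = b + \<Phi> r\<close>, where \<open>b\<close> is a linear image of
  \<open>(x, w, u)\<close>, hence the primitive of a locally square integrable \<open>\<beta>\<close>, and \<open>\<Phi>\<close> is the causal memory
  operator. Since \<open>\<Phi>\<close> commutes with taking primitives, iteration gives
  \<open>r = (\<Sum>k<n. primitive (\<Phi>\<^sup>k \<beta>)) + \<Phi>\<^sup>n r\<close>. In an exponentially weighted \<open>L\<^sup>2\<close> norm \<open>\<Phi>\<close> is a contraction,
  so \<open>\<Sum>k. \<Phi>\<^sup>k \<beta>\<close> converges to a locally square integrable \<open>h\<close>; and \<open>\<Phi>\<^sup>n r\<close> tends to \<open>0\<close> at every
  point because the pure delays are positive. Hence \<open>r\<close> is the primitive of \<open>h\<close>.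
\<close>

section \<open>Causal, locally square integrable signals\<close>

text \<open>Solving on successive intervals shorter than the smallest delay is blocked by the
  distributed delays: their windows reach up to the present time, so even on a short interval
  \<open>r\<close> stands on both sides of its equation. Iteration in an exponential weight treats
  both kinds of delay together: a pure delay by s multiplies the energy by at most exp(-l s), a
  distributed one by at most c / l, and both factors become small as \<open>l\<close> grows. Energy
  estimates alone would identify \<open>r\<close> with a primitive only almost everywhere, while the
  NDS and \<open>W12\<close> fix every point value; hence a second, pointwise convergence, and there
  the argument by steps in time returns. Zero history is what makes primitives taken from 0 commute
  with delays: a jump of \<open>r\<close> at time 0 would be passed on by the neutral terms instead
  of being smoothed out. The converse direction is light: a window in \<open>W12\<close> is square
  integrable by definition, and x' is the last block of \<open>r\<close>. Energies take values in
  \<open>ennreal\<close>, so suprema, series and exchanges of integrals can be handled before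
  finiteness is known.\<close>

definition energy :: "real \<Rightarrow> real \<Rightarrow> (real \<Rightarrow> 'a::euclidean_space) \<Rightarrow> ennreal" where
  "energy l T h = (\<integral>\<^sup>+t. ennreal (exp (- (l * t)) * (norm (h t))\<^sup>2) * indicator {..T} t \<partial>lborel)"

text \<open>Functions, not classes: point values matter for the pure delays. Borel measurability
  survives translations and products, as the Fubini arguments require. The value at 0 is left free,
  since \<open>tderiv x 0\<close> is not known to vanish in advance.\<close>

definition causal_L2 :: "(real \<Rightarrow> 'a::euclidean_space) \<Rightarrow> bool" where
  "causal_L2 h \<longleftrightarrow> h \<in> borel_measurable borel \<and> (\<forall>t<0. h t = 0) \<and> (\<forall>T. energy 0 T h < \<infinity>)"

text \<open>For t < 0 the interval is empty, so a primitive is again causal. For causal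
  \<open>h\<close> the lower limit 0 amounts to minus infinity.\<close>

definition primitive :: "(real \<Rightarrow> 'a::euclidean_space) \<Rightarrow> real \<Rightarrow> 'a" where
  "primitive h t = (LINT s:{0..t}|lborel. h s)"

lemma causal_L2_measurable[measurable_dest]: "causal_L2 h \<Longrightarrow> h \<in> borel_measurable borel"
  by (simp add: causal_L2_def)

lemma causal_L2_neg: "causal_L2 h \<Longrightarrow> t < 0 \<Longrightarrow> h t = 0"
  by (simp add: causal_L2_def)

lemma energy_mono_AE:
  assumes "AE t in lborel. t \<le> T \<longrightarrow> norm (f t) \<le> C * norm (g t)"
    and [measurable]: "g \<in> borel_measurable borel"
  shows "energy l T f \<le> ennreal (C\<^sup>2) * energy l T g"
proof -
  have "energy l T f \<le> (\<integral>\<^sup>+t. ennreal (C\<^sup>2) * (ennreal (exp (- (l * t)) * (norm (g t))\<^sup>2) * indicator {..T} t) \<partial>lborel)"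
    unfolding energy_def
  proof (rule nn_integral_mono_AE, use assms(1) in eventually_elim)
    case (elim t)
    show ?case
    proof (cases "t \<le> T")
      case True
      have "(norm (f t))\<^sup>2 \<le> C\<^sup>2 * (norm (g t))\<^sup>2"
        using elim True by (metis norm_ge_zero power_mono power_mult_distrib)
      then have "exp (- (l * t)) * (norm (f t))\<^sup>2 \<le> C\<^sup>2 * (exp (- (l * t)) * (norm (g t))\<^sup>2)"
        by (simp add: mult.left_commute)
      then show ?thesis
        using True by (simp flip: ennreal_mult)
    qed simp
  qed
  also have "\<dots> = ennreal (C\<^sup>2) * energy l T g"
    unfolding energy_def by (rule nn_integral_cmult) measurable
  finally show ?thesis .
qed

text \<open>Rests on (a + b)^2 \<le> 2 a^2 + 2 b^2 and stands in for the triangle inequality of the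
  norm, without square roots in \<open>ennreal\<close>. The lost factor is harmless because
  contraction constants can be made as small as desired.\<close>

lemma energy_add:
  assumes [measurable]: "f \<in> borel_measurable borel" "g \<in> borel_measurable borel"
  shows "energy l T (\<lambda>t. f t + g t) \<le> 2 * energy l T f + 2 * energy l T g"
proof -
  have "energy l T (\<lambda>t. f t + g t) \<le> (\<integral>\<^sup>+t. 2 * (ennreal (exp (- (l * t)) * (norm (f t))\<^sup>2) * indicator {..T} t)
      + 2 * (ennreal (exp (- (l * t)) * (norm (g t))\<^sup>2) * indicator {..T} t) \<partial>lborel)"
    unfolding energy_def
  proof (rule nn_integral_mono)
    fix t
    have "(norm (f t + g t))\<^sup>2 \<le> (norm (f t) + norm (g t))\<^sup>2"
      by (simp add: norm_triangle_ineq power_mono)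
    also have "\<dots> \<le> 2 * (norm (f t))\<^sup>2 + 2 * (norm (g t))\<^sup>2"
      using sum_squares_bound[of "norm (f t)" "norm (g t)"] by (simp add: power2_sum)
    finally have "exp (- (l * t)) * (norm (f t + g t))\<^sup>2
        \<le> exp (- (l * t)) * (2 * (norm (f t))\<^sup>2 + 2 * (norm (g t))\<^sup>2)"
      by simp
    also have "\<dots> = 2 * (exp (- (l * t)) * (norm (f t))\<^sup>2) + 2 * (exp (- (l * t)) * (norm (g t))\<^sup>2)"
      by (simp add: algebra_simps)
    finally have "ennreal (exp (- (l * t)) * (norm (f t + g t))\<^sup>2)
        \<le> ennreal (2 * (exp (- (l * t)) * (norm (f t))\<^sup>2) + 2 * (exp (- (l * t)) * (norm (g t))\<^sup>2))"
      by (rule ennreal_leI)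
    also have "\<dots> = 2 * ennreal (exp (- (l * t)) * (norm (f t))\<^sup>2) + 2 * ennreal (exp (- (l * t)) * (norm (g t))\<^sup>2)"
      by (simp add: ennreal_plus ennreal_mult')
    finally show "ennreal (exp (- (l * t)) * (norm (f t + g t))\<^sup>2) * indicator {..T} t
      \<le> 2 * (ennreal (exp (- (l * t)) * (norm (f t))\<^sup>2) * indicator {..T} t)
      + 2 * (ennreal (exp (- (l * t)) * (norm (g t))\<^sup>2) * indicator {..T} t)"
      by (simp split: split_indicator)
  qed
  also have "\<dots> = 2 * energy l T f + 2 * energy l T g"
    unfolding energy_def by (subst nn_integral_add) (auto simp: nn_integral_cmult)
  finally show ?thesis .
qed

lemma energy_le_unweighted:
  assumes "\<And>t. t < 0 \<Longrightarrow> h t = 0" "0 \<le> l"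
  shows "energy l T h \<le> energy 0 T h"
  unfolding energy_def
proof (rule nn_integral_mono)
  fix t
  have "exp (- (l * t)) * (norm (h t))\<^sup>2 \<le> (norm (h t))\<^sup>2"
    using assms by (cases "t < 0") (auto intro!: mult_left_le_one_le)
  then show "ennreal (exp (- (l * t)) * (norm (h t))\<^sup>2) * indicator {..T} t
      \<le> ennreal (exp (- (0 * t)) * (norm (h t))\<^sup>2) * indicator {..T} t"
    by (auto intro!: mult_right_mono ennreal_leI)
qed

text \<open>On t \<le> T the weight is at least exp(-l T). Together with
  \<open>energy_le_unweighted\<close> this makes local finiteness of the energy of a causal signal
  independent of the weight.\<close>

lemma unweighted_le_energy:
  assumes [measurable]: "h \<in> borel_measurable borel" and "0 \<le> l"
  shows "energy 0 T h \<le> ennreal (exp (l * T)) * energy l T h"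
proof -
  have "energy 0 T h \<le> (\<integral>\<^sup>+t. ennreal (exp (l * T)) * (ennreal (exp (- (l * t)) * (norm (h t))\<^sup>2) * indicator {..T} t) \<partial>lborel)"
    unfolding energy_def
  proof (rule nn_integral_mono)
    fix t
    show "ennreal (exp (- (0 * t)) * (norm (h t))\<^sup>2) * indicator {..T} t
      \<le> ennreal (exp (l * T)) * (ennreal (exp (- (l * t)) * (norm (h t))\<^sup>2) * indicator {..T} t)"
    proof (cases "t \<le> T")
      case True
      have "1 * (norm (h t))\<^sup>2 \<le> exp (l * T - l * t) * (norm (h t))\<^sup>2"
        by (intro mult_right_mono) (use True assms in \<open>auto intro: mult_left_mono\<close>)
      also have "\<dots> = exp (l * T) * (exp (- (l * t)) * (norm (h t))\<^sup>2)"
        by (simp add: exp_diff exp_minus field_simps)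
      finally show ?thesis using True by (simp flip: ennreal_mult)
    qed simp
  qed
  also have "\<dots> = ennreal (exp (l * T)) * energy l T h"
    unfolding energy_def by (rule nn_integral_cmult) measurable
  finally show ?thesis .
qed

lemma causal_L2I_energy:
  assumes "h \<in> borel_measurable borel" "\<And>t. t < 0 \<Longrightarrow> h t = 0" "0 \<le> l" "\<And>T. energy l T h < \<infinity>"
  shows "causal_L2 h"
  unfolding causal_L2_def
proof (intro conjI allI impI)
  fix T
  show "energy 0 T h < \<infinity>"
    using unweighted_le_energy[OF assms(1,3), of T] assms(4)[of T]
    by (auto simp: ennreal_mult_less_top intro: le_less_trans)
qed (use assms in auto)

lemma causal_L2_energy_finite: "causal_L2 h \<Longrightarrow> 0 \<le> l \<Longrightarrow> energy l T h < \<infinity>"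
  using energy_le_unweighted[of h l T] unfolding causal_L2_def
  by (metis le_less_trans)

lemma causal_L2_add:
  assumes "causal_L2 f" "causal_L2 g"
  shows "causal_L2 (\<lambda>t. f t + g t)"
proof (rule causal_L2I_energy[of _ 0])
  show "(\<lambda>t. f t + g t) \<in> borel_measurable borel"
    using assms by (auto simp: causal_L2_def)
  show "energy 0 T (\<lambda>t. f t + g t) < \<infinity>" for T
    using energy_add[of f g 0 T] assms
    by (auto simp: causal_L2_def ennreal_mult_less_top intro: le_less_trans)
qed (use assms in \<open>auto simp: causal_L2_def\<close>)

lemma causal_L2_zero: "causal_L2 (\<lambda>t. 0)"
  by (simp add: causal_L2_def energy_def)

lemma causal_L2_linear:
  assumes "causal_L2 f" "bounded_linear A"
  shows "causal_L2 (\<lambda>t. A (f t))"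
proof -
  interpret A: bounded_linear A by fact
  have [measurable]: "f \<in> borel_measurable borel" using assms by (auto simp: causal_L2_def)
  have [measurable]: "A \<in> borel_measurable borel"
    by (intro borel_measurable_continuous_onI linear_continuous_on assms)
  show ?thesis
  proof (rule causal_L2I_energy[of _ 0])
    show "energy 0 T (\<lambda>t. A (f t)) < \<infinity>" for T
    proof -
      have "energy 0 T (\<lambda>t. A (f t)) \<le> ennreal ((onorm A)\<^sup>2) * energy 0 T f"
        by (rule energy_mono_AE) (auto intro!: AE_I2 onorm assms)
      also have "\<dots> < \<infinity>" using assms by (auto simp: causal_L2_def ennreal_mult_less_top)
      finally show ?thesis .
    qed
  qed (use assms in \<open>auto simp: causal_L2_def A.zero\<close>)
qed

lemma causal_L2_bounded:
  assumes [measurable]: "h \<in> borel_measurable borel" and "\<And>t. t < 0 \<Longrightarrow> h t = 0"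
    and "\<And>T. \<exists>C. \<forall>t\<le>T. norm (h t) \<le> C"
  shows "causal_L2 h"
proof (rule causal_L2I_energy[of _ 0])
  fix T
  obtain C where C: "\<forall>t\<le>T. norm (h t) \<le> C" using assms(3) by blast
  have "energy 0 T h \<le> (\<integral>\<^sup>+t. ennreal (C\<^sup>2) * indicator {0..T} t \<partial>lborel)"
    unfolding energy_def
    using C assms(2) by (intro nn_integral_mono) (auto split: split_indicator intro!: ennreal_leI power_mono)
  also have "\<dots> = ennreal (C\<^sup>2) * emeasure lborel {0..T}"
    by (rule nn_integral_cmult_indicator) simp
  also have "\<dots> < \<infinity>" by (simp add: ennreal_mult_less_top emeasure_lborel_Icc_eq)
  finally show "energy 0 T h < \<infinity>" .
qed (use assms in auto)

text \<open>The bound a \<le> 1 + a^2 takes the place of Cauchy-Schwarz. The constant 1 is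
  integrated over \<open>{0..T}\<close> only, because the signal vanishes at negative times.\<close>

lemma causal_L2_integrable:
  assumes "causal_L2 h"
  shows "set_integrable lborel {..T} h"
  unfolding set_integrable_def
proof (rule integrableI_bounded)
  have [measurable]: "h \<in> borel_measurable borel" using assms by (auto simp: causal_L2_def)
  show "(\<lambda>x. indicat_real {..T} x *\<^sub>R h x) \<in> borel_measurable lborel" by simp
  have "(\<integral>\<^sup>+x. ennreal (norm (indicat_real {..T} x *\<^sub>R h x)) \<partial>lborel)
     \<le> (\<integral>\<^sup>+t. indicator {0..T} t + ennreal (exp (- (0 * t)) * (norm (h t))\<^sup>2) * indicator {..T} t \<partial>lborel)"
  proof (rule nn_integral_mono)
    fix t
    have "norm (h t) \<le> 1 + (norm (h t))\<^sup>2"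
      using sum_squares_bound[of 1 "norm (h t)"] norm_ge_zero[of "h t"] by (simp add: power2_eq_square del: norm_ge_zero)
    then have "ennreal (norm (h t)) \<le> 1 + ennreal ((norm (h t))\<^sup>2)"
      by (simp flip: ennreal_1 ennreal_plus add: ennreal_leI)
    then show "ennreal (norm (indicat_real {..T} t *\<^sub>R h t)) \<le> indicator {0..T} t + ennreal (exp (- (0 * t)) * (norm (h t))\<^sup>2) * indicator {..T} t"
      using causal_L2_neg[OF assms, of t] by (auto split: split_indicator)
  qed
  also have "\<dots> = emeasure lborel {0..T} + energy 0 T h"
    unfolding energy_def by (subst nn_integral_add) auto
  also have "\<dots> < \<infinity>"
    using assms by (auto simp: causal_L2_def emeasure_lborel_Icc_eq)
  finally show "(\<integral>\<^sup>+x. ennreal (norm (indicat_real {..T} x *\<^sub>R h x)) \<partial>lborel) < \<infinity>" .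
qed

lemma causal_L2_integrable_subset:
  assumes "causal_L2 h" "A \<in> sets borel" "A \<subseteq> {..T}"
  shows "set_integrable lborel A h"
  using causal_L2_integrable[OF assms(1)] by (rule set_integrable_subset) (use assms in auto)

lemma primitive_add:
  assumes "causal_L2 f" "causal_L2 g"
  shows "primitive (\<lambda>t. f t + g t) t = primitive f t + primitive g t"
  unfolding primitive_def
  by (rule set_integral_add) (auto intro!: causal_L2_integrable_subset[where T=t] assms)

lemma primitive_linear:
  assumes "causal_L2 f" "bounded_linear A"
  shows "primitive (\<lambda>t. A (f t)) t = A (primitive f t)"
proof -
  have "set_integrable lborel {0..t} f"
    by (auto intro!: causal_L2_integrable_subset[where T=t] assms)
  then show ?thesis
    unfolding primitive_def set_lebesgue_integral_def set_integrable_def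
    by (subst integral_bounded_linear[OF assms(2), symmetric])
       (auto simp: linear_simps[OF assms(2)])
qed

lemma primitive_neg: "t \<le> 0 \<Longrightarrow> primitive h t = 0"
proof (cases "t = 0")
  case True
  have "AE s in lborel. indicat_real {0} s *\<^sub>R h s = 0"
    by (rule AE_mp[OF AE_lborel_singleton[of 0]]) auto
  with True show ?thesis
    unfolding primitive_def set_lebesgue_integral_def by (simp add: integral_eq_zero_AE)
next
  case False
  assume "t \<le> 0"
  with False have "{0..t} = {}" by auto
  then show ?thesis by (simp add: primitive_def set_lebesgue_integral_def)
qed

lemma primitive_bound:
  assumes "causal_L2 h"
  shows "\<exists>C. \<forall>t\<le>T. norm (primitive h t) \<le> C"
proof (intro exI allI impI)
  fix t assume "t \<le> T"
  have 1: "set_integrable lborel {..T} h" by (rule causal_L2_integrable[OF assms])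
  have "norm (primitive h t) \<le> (LINT s|lborel. norm (indicat_real {..T} s *\<^sub>R h s))"
    unfolding primitive_def set_lebesgue_integral_def
  proof (rule Bochner_Integration.integral_norm_bound_integral)
    show "integrable lborel (\<lambda>s. indicat_real {0..t} s *\<^sub>R h s)"
      using causal_L2_integrable_subset[OF assms, of "{0..t}" t] by (auto simp: set_integrable_def)
    show "integrable lborel (\<lambda>s. norm (indicat_real {..T} s *\<^sub>R h s))"
      using 1 unfolding set_integrable_def by (rule integrable_norm)
  qed (use \<open>t \<le> T\<close> in \<open>auto split: split_indicator\<close>)
  then show "norm (primitive h t) \<le> (LINT s|lborel. norm (indicator {..T} s *\<^sub>R h s))" .
qed

lemma primitive_measurable:
  assumes [measurable]: "h \<in> borel_measurable borel"
  shows "primitive h \<in> borel_measurable borel"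
proof -
  \<comment> \<open>As an integral of a jointly measurable function of (t, s), the primitive is
    measurable in the parameter t.\<close>
  have "primitive h = (\<lambda>t. LINT s|lborel. (if 0 \<le> s \<and> s \<le> t then h s else 0))"
    unfolding primitive_def set_lebesgue_integral_def
    by (intro ext Bochner_Integration.integral_cong) (auto split: split_indicator)
  also have "\<dots> \<in> borel_measurable borel" by measurable
  finally show ?thesis .
qed

lemma causal_L2_primitive: "causal_L2 h \<Longrightarrow> causal_L2 (primitive h)"
  by (rule causal_L2_bounded)
     (simp_all add: primitive_neg primitive_bound primitive_measurable causal_L2_measurable)

section \<open>Memory operators\<close>

text \<open>
  The last condition expresses that \<open>\<Phi> h t\<close> sees point values of \<open>h\<close> only with a delay of more than
  \<open>\<delta>\<close>, and otherwise depends on \<open>h\<close> only through its energy. It is needed because the fixed point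
  equation is to be solved at every point, not merely almost everywhere.
\<close>

definition memory_op :: "((real \<Rightarrow> 'a::euclidean_space) \<Rightarrow> real \<Rightarrow> 'b::euclidean_space) \<Rightarrow> bool" where
  "memory_op \<Phi> \<longleftrightarrow>
     (\<forall>h. causal_L2 h \<longrightarrow> \<Phi> h \<in> borel_measurable borel \<and> (\<forall>t<0. \<Phi> h t = 0)) \<and>
     (\<forall>f g t. causal_L2 f \<longrightarrow> causal_L2 g \<longrightarrow> \<Phi> (\<lambda>t. f t + g t) t = \<Phi> f t + \<Phi> g t) \<and>
     (\<forall>h t. causal_L2 h \<longrightarrow> \<Phi> (primitive h) t = primitive (\<Phi> h) t) \<and>
     (\<forall>\<epsilon>>0. \<forall>\<^sub>F l in at_top. \<forall>h T. causal_L2 h \<longrightarrow> energy l T (\<Phi> h) \<le> ennreal \<epsilon> * energy l T h) \<and>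
     (\<forall>l\<ge>0. \<forall>\<^sub>F \<delta> in at_right 0. \<forall>d t.
        (\<forall>n. causal_L2 (d n)) \<longrightarrow> (\<forall>T. (\<lambda>n. energy l T (d n)) \<longlonglongrightarrow> 0) \<longrightarrow>
        (\<forall>s\<le>t - \<delta>. (\<lambda>n. d n s) \<longlonglongrightarrow> 0) \<longrightarrow> (\<lambda>n. \<Phi> (d n) t) \<longlonglongrightarrow> 0)"

lemma memory_opI:
  assumes "\<And>h. causal_L2 h \<Longrightarrow> \<Phi> h \<in> borel_measurable borel"
    and "\<And>h t. causal_L2 h \<Longrightarrow> t < 0 \<Longrightarrow> \<Phi> h t = 0"
    and "\<And>f g t. causal_L2 f \<Longrightarrow> causal_L2 g \<Longrightarrow> \<Phi> (\<lambda>t. f t + g t) t = \<Phi> f t + \<Phi> g t"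
    and "\<And>h t. causal_L2 h \<Longrightarrow> \<Phi> (primitive h) t = primitive (\<Phi> h) t"
    and "\<And>\<epsilon>. 0 < \<epsilon> \<Longrightarrow> \<forall>\<^sub>F l in at_top. \<forall>h T. causal_L2 h \<longrightarrow> energy l T (\<Phi> h) \<le> ennreal \<epsilon> * energy l T h"
    and "\<And>l. 0 \<le> l \<Longrightarrow> \<forall>\<^sub>F \<delta> in at_right 0. \<forall>d t.
        (\<forall>n. causal_L2 (d n)) \<longrightarrow> (\<forall>T. (\<lambda>n. energy l T (d n)) \<longlonglongrightarrow> 0) \<longrightarrow>
        (\<forall>s\<le>t - \<delta>. (\<lambda>n. d n s) \<longlonglongrightarrow> 0) \<longrightarrow> (\<lambda>n. \<Phi> (d n) t) \<longlonglongrightarrow> 0"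
  shows "memory_op \<Phi>"
  unfolding memory_op_def using assms by blast

lemma memory_opD:
  assumes "memory_op \<Phi>"
  shows memory_op_measurable: "causal_L2 h \<Longrightarrow> \<Phi> h \<in> borel_measurable borel"
    and memory_op_neg: "causal_L2 h \<Longrightarrow> t < 0 \<Longrightarrow> \<Phi> h t = 0"
    and memory_op_plus: "causal_L2 f \<Longrightarrow> causal_L2 g \<Longrightarrow> \<Phi> (\<lambda>t. f t + g t) t = \<Phi> f t + \<Phi> g t"
    and memory_op_primitive: "causal_L2 h \<Longrightarrow> \<Phi> (primitive h) t = primitive (\<Phi> h) t"
    and memory_op_energy: "0 < \<epsilon> \<Longrightarrow>
      \<forall>\<^sub>F l in at_top. \<forall>h T. causal_L2 h \<longrightarrow> energy l T (\<Phi> h) \<le> ennreal \<epsilon> * energy l T h"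
    and memory_op_tendsto: "0 \<le> l \<Longrightarrow> \<forall>\<^sub>F \<delta> in at_right 0. \<forall>d t.
        (\<forall>n. causal_L2 (d n)) \<longrightarrow> (\<forall>T. (\<lambda>n. energy l T (d n)) \<longlonglongrightarrow> 0) \<longrightarrow>
        (\<forall>s\<le>t - \<delta>. (\<lambda>n. d n s) \<longlonglongrightarrow> 0) \<longrightarrow> (\<lambda>n. \<Phi> (d n) t) \<longlonglongrightarrow> 0"
  using assms unfolding memory_op_def by blast+

text \<open>A single weight at which \<open>\<Phi>\<close> is bounded suffices, since local
  finiteness of the energy does not depend on the weight.\<close>

lemma memory_op_causal_L2:
  assumes "memory_op \<Phi>" "causal_L2 h"
  shows "causal_L2 (\<Phi> h)"
proof -
  have "\<forall>\<^sub>F l in at_top. (\<forall>h T. causal_L2 h \<longrightarrow> energy l T (\<Phi> h) \<le> ennreal 1 * energy l T h) \<and> 0 \<le> l"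
    using memory_op_energy[OF assms(1), of 1] eventually_ge_at_top[of "0::real"] by (auto intro: eventually_conj)
  then obtain l :: real where l: "0 \<le> l" "energy l T (\<Phi> h) \<le> energy l T h" for T
    using assms(2) by (auto dest!: eventually_happens)
  show ?thesis
    using l causal_L2_energy_finite[OF assms(2) l(1)] memory_opD[OF assms(1)] assms(2)
    by (intro causal_L2I_energy[of _ l]) (auto intro: le_less_trans)
qed

lemma memory_op_add:
  assumes "memory_op \<Phi>" "memory_op \<Psi>"
  shows "memory_op (\<lambda>h t. \<Phi> h t + \<Psi> h t)"
proof (rule memory_opI)
  fix h :: "real \<Rightarrow> 'a" and t :: real assume h: "causal_L2 h"
  show "(\<lambda>t. \<Phi> h t + \<Psi> h t) \<in> borel_measurable borel"
    using h memory_op_measurable[OF assms(1)] memory_op_measurable[OF assms(2)] by auto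
  show "\<Phi> h t + \<Psi> h t = 0" if "t < 0"
    using h memory_op_neg[OF assms(1)] memory_op_neg[OF assms(2)] that by auto
  show "\<Phi> (primitive h) t + \<Psi> (primitive h) t = primitive (\<lambda>t. \<Phi> h t + \<Psi> h t) t"
    using primitive_add[OF memory_op_causal_L2[OF assms(1) h] memory_op_causal_L2[OF assms(2) h]]
    by (simp add: memory_op_primitive[OF assms(1) h] memory_op_primitive[OF assms(2) h])
next
  fix f g :: "real \<Rightarrow> 'a" and t :: real assume "causal_L2 f" "causal_L2 g"
  then show "\<Phi> (\<lambda>t. f t + g t) t + \<Psi> (\<lambda>t. f t + g t) t = \<Phi> f t + \<Psi> f t + (\<Phi> g t + \<Psi> g t)"
    by (simp add: memory_op_plus assms)
next
  fix \<epsilon> :: real assume "0 < \<epsilon>"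
  \<comment> \<open>A quarter for each operator: two summands, each doubled by
    \<open>energy_add\<close>.\<close>
  then have "0 < \<epsilon> / 4" by simp
  from memory_op_energy[OF assms(1) this] memory_op_energy[OF assms(2) this]
  show "\<forall>\<^sub>F l in at_top. \<forall>h T. causal_L2 h \<longrightarrow>
      energy l T (\<lambda>t. \<Phi> h t + \<Psi> h t) \<le> ennreal \<epsilon> * energy l T h"
  proof (eventually_elim, intro allI impI)
    fix l T and h :: "real \<Rightarrow> 'a"
    assume *: "\<forall>h T. causal_L2 h \<longrightarrow> energy l T (\<Phi> h) \<le> ennreal (\<epsilon> / 4) * energy l T h"
      "\<forall>h T. causal_L2 h \<longrightarrow> energy l T (\<Psi> h) \<le> ennreal (\<epsilon> / 4) * energy l T h" and h: "causal_L2 h"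
    have "energy l T (\<lambda>t. \<Phi> h t + \<Psi> h t) \<le> 2 * energy l T (\<Phi> h) + 2 * energy l T (\<Psi> h)"
      by (intro energy_add memory_op_measurable assms h)
    also have "\<dots> \<le> 2 * (ennreal (\<epsilon> / 4) * energy l T h) + 2 * (ennreal (\<epsilon> / 4) * energy l T h)"
      using * h by (intro add_mono mult_left_mono) auto
    also have "\<dots> = ennreal 4 * ennreal (\<epsilon> / 4) * energy l T h"
      by (simp add: mult.assoc flip: distrib_right)
    also have "ennreal 4 * ennreal (\<epsilon> / 4) = ennreal \<epsilon>"
      using \<open>0 < \<epsilon>\<close> by (subst ennreal_mult[symmetric]) auto
    finally show "energy l T (\<lambda>t. \<Phi> h t + \<Psi> h t) \<le> ennreal \<epsilon> * energy l T h" .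
  qed
next
  fix l :: real assume "0 \<le> l"
  from memory_op_tendsto[OF assms(1) this] memory_op_tendsto[OF assms(2) this]
  show "\<forall>\<^sub>F \<delta> in at_right 0. \<forall>d t. (\<forall>n. causal_L2 (d n)) \<longrightarrow>
      (\<forall>T. (\<lambda>n. energy l T (d n)) \<longlonglongrightarrow> 0) \<longrightarrow> (\<forall>s\<le>t - \<delta>. (\<lambda>n. d n s) \<longlonglongrightarrow> 0) \<longrightarrow>
      (\<lambda>n. \<Phi> (d n) t + \<Psi> (d n) t) \<longlonglongrightarrow> 0"
  proof eventually_elim
    case (elim \<delta>)
    show ?case
      by (intro allI impI tendsto_add_zero) (simp_all add: elim)
  qed
qed

lemma memory_op_zero: "memory_op (\<lambda>h t. 0)"
proof (rule memory_opI)
  show "(0::'b) = primitive (\<lambda>t. 0) t" for t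
    by (simp add: primitive_def)
qed (auto simp: energy_def)

lemma memory_op_sum:
  assumes "finite I" "\<And>i. i \<in> I \<Longrightarrow> memory_op (\<Phi> i)"
  shows "memory_op (\<lambda>h t. \<Sum>i\<in>I. \<Phi> i h t)"
  using assms
proof (induction I)
  case empty
  show ?case by (simp add: memory_op_zero)
next
  case (insert i I)
  then have "memory_op (\<lambda>h t. \<Phi> i h t + (\<Sum>i\<in>I. \<Phi> i h t))"
    by (intro memory_op_add) auto
  with insert show ?case by simp
qed

lemma memory_op_linear:
  assumes "memory_op \<Phi>" "bounded_linear A"
  shows "memory_op (\<lambda>h t. A (\<Phi> h t))"
proof -
  interpret A: bounded_linear A by fact
  have [measurable]: "A \<in> borel_measurable borel"
    by (intro borel_measurable_continuous_onI linear_continuous_on assms)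
  show ?thesis
  proof (rule memory_opI)
    fix h :: "real \<Rightarrow> 'a" and t :: real assume h: "causal_L2 h"
    have [measurable]: "\<Phi> h \<in> borel_measurable borel"
      by (rule memory_op_measurable[OF assms(1) h])
    show "(\<lambda>t. A (\<Phi> h t)) \<in> borel_measurable borel" by measurable
    show "A (\<Phi> h t) = 0" if "t < 0"
      using h memory_op_neg[OF assms(1)] that by (auto simp: A.zero)
    show "A (\<Phi> (primitive h) t) = primitive (\<lambda>t. A (\<Phi> h t)) t"
      using primitive_linear[OF memory_op_causal_L2[OF assms(1) h] assms(2)]
      by (simp add: memory_op_primitive[OF assms(1) h])
  next
    fix f g :: "real \<Rightarrow> 'a" and t :: real assume "causal_L2 f" "causal_L2 g"
    then show "A (\<Phi> (\<lambda>t. f t + g t) t) = A (\<Phi> f t) + A (\<Phi> g t)"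
      by (simp add: memory_op_plus assms A.add)
  next
    fix \<epsilon> :: real assume "0 < \<epsilon>"
    \<comment> \<open>The summand 1 keeps C positive when A is the zero map, so that the division by
      C is legitimate.\<close>
    define C where "C = (onorm A)\<^sup>2 + 1"
    have C: "0 < C" unfolding C_def by (simp add: add_nonneg_pos)
    then have "0 < \<epsilon> / C" using \<open>0 < \<epsilon>\<close> by simp
    from memory_op_energy[OF assms(1) this]
    show "\<forall>\<^sub>F l in at_top. \<forall>h T. causal_L2 h \<longrightarrow>
        energy l T (\<lambda>t. A (\<Phi> h t)) \<le> ennreal \<epsilon> * energy l T h"
    proof (eventually_elim, intro allI impI)
      fix l T and h :: "real \<Rightarrow> 'a"
      assume *: "\<forall>h T. causal_L2 h \<longrightarrow> energy l T (\<Phi> h) \<le> ennreal (\<epsilon> / C) * energy l T h"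
        and h: "causal_L2 h"
      have "energy l T (\<lambda>t. A (\<Phi> h t)) \<le> ennreal ((onorm A)\<^sup>2) * energy l T (\<Phi> h)"
        by (intro energy_mono_AE) (auto intro!: AE_I2 onorm assms memory_op_measurable[OF assms(1) h])
      also have "\<dots> \<le> ennreal C * (ennreal (\<epsilon> / C) * energy l T h)"
        using * h by (intro mult_mono) (auto simp: C_def intro!: ennreal_leI)
      also have "\<dots> = ennreal (C * (\<epsilon> / C)) * energy l T h"
        using \<open>0 < \<epsilon>\<close> C by (simp add: ennreal_mult mult.assoc del: times_divide_eq_right)
      finally show "energy l T (\<lambda>t. A (\<Phi> h t)) \<le> ennreal \<epsilon> * energy l T h" using C by simp
    qed
  next
    fix l :: real assume "0 \<le> l"
    from memory_op_tendsto[OF assms(1) this]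
    show "\<forall>\<^sub>F \<delta> in at_right 0. \<forall>d t. (\<forall>n. causal_L2 (d n)) \<longrightarrow>
        (\<forall>T. (\<lambda>n. energy l T (d n)) \<longlonglongrightarrow> 0) \<longrightarrow> (\<forall>s\<le>t - \<delta>. (\<lambda>n. d n s) \<longlonglongrightarrow> 0) \<longrightarrow>
        (\<lambda>n. A (\<Phi> (d n) t)) \<longlonglongrightarrow> 0"
    proof eventually_elim
      case (elim \<delta>)
      show ?case
        by (intro allI impI A.tendsto_zero) (simp add: elim)
    qed
  qed
qed

section \<open>Pure delays\<close>

lemma energy_shift:
  assumes [measurable]: "h \<in> borel_measurable borel" and s: "0 \<le> s"
  shows "(\<integral>\<^sup>+t. ennreal (exp (- (l * (t - s))) * (norm (h (t - s)))\<^sup>2) * indicator {..T} t \<partial>lborel) \<le> energy l T h"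
proof -
  \<comment> \<open>Substituting t - s turns the cutoff into t - s \<le> T, a set that contains t
    \<le> T because s is nonnegative.\<close>
  have "energy l T h = (\<integral>\<^sup>+t. ennreal (exp (- (l * (t - s))) * (norm (h (t - s)))\<^sup>2) * indicator {..T} (t - s) \<partial>lborel)"
    unfolding energy_def by (subst nn_integral_real_affine[where c=1 and t="-s"]) simp_all
  also have "\<dots> \<ge> (\<integral>\<^sup>+t. ennreal (exp (- (l * (t - s))) * (norm (h (t - s)))\<^sup>2) * indicator {..T} t \<partial>lborel)"
    by (intro nn_integral_mono) (use s in \<open>auto split: split_indicator\<close>)
  finally show ?thesis .
qed

text \<open>After substitution the right-hand side integrates h(r - s) over s \<le> r \<le> t and
  the left-hand side over 0 \<le> r \<le> t; on the extra piece r < s the integrand vanishes by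
  causality.\<close>

lemma primitive_shift:
  assumes "causal_L2 h" "0 \<le> s"
  shows "primitive (\<lambda>t. h (t - s)) t = primitive h (t - s)"
proof -
  have "primitive h (t - s) = (LINT r|lborel. indicat_real {0..t - s} (r - s) *\<^sub>R h (r - s))"
    unfolding primitive_def set_lebesgue_integral_def
    by (subst lborel_integral_real_affine[where c=1 and t="-s"]) simp_all
  also have "\<dots> = primitive (\<lambda>t. h (t - s)) t"
    unfolding primitive_def set_lebesgue_integral_def
    by (intro Bochner_Integration.integral_cong)
       (use causal_L2_neg[OF assms(1)] assms(2) in \<open>auto split: split_indicator\<close>)
  finally show ?thesis ..
qed

text \<open>Moving a signal to the right by s costs exactly a factor exp(-l s) in the weight, which
  tends to 0 as l grows since s > 0. The same positivity allows any \<delta> below s in the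
  pointwise condition: t - s then lies below t - \<delta>.\<close>

lemma memory_op_delay:
  assumes "0 < s"
  shows "memory_op (\<lambda>h t. h (t - s))"
proof (rule memory_opI)
  fix h :: "real \<Rightarrow> 'a" and t :: real assume h: "causal_L2 h"
  then have [measurable]: "h \<in> borel_measurable borel" by (rule causal_L2_measurable)
  show "(\<lambda>t. h (t - s)) \<in> borel_measurable borel" by measurable
  show "h (t - s) = 0" if "t < 0"
    using h that assms by (auto intro: causal_L2_neg)
  show "primitive h (t - s) = primitive (\<lambda>t. h (t - s)) t"
    using h assms by (simp add: primitive_shift)
next
  fix \<epsilon> :: real assume "0 < \<epsilon>"
  have "((\<lambda>l. exp (- (l * s))) \<longlongrightarrow> 0) at_top"
    by (rule filterlim_compose[OF exp_at_bot], subst filterlim_uminus_at_bot)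
       (use assms in \<open>auto intro!: filterlim_at_top_mult_tendsto_pos filterlim_ident\<close>)
  then have "\<forall>\<^sub>F l in at_top. exp (- (l * s)) < \<epsilon>"
    using \<open>0 < \<epsilon>\<close> by (rule order_tendstoD)
  then show "\<forall>\<^sub>F l in at_top. \<forall>h T. causal_L2 (h::real \<Rightarrow> 'a) \<longrightarrow>
      energy l T (\<lambda>t. h (t - s)) \<le> ennreal \<epsilon> * energy l T h"
  proof (eventually_elim, intro allI impI)
    fix l T and h :: "real \<Rightarrow> 'a"
    assume l: "exp (- (l * s)) < \<epsilon>" and h: "causal_L2 h"
    then have [measurable]: "h \<in> borel_measurable borel" by (auto intro: causal_L2_measurable)
    have "energy l T (\<lambda>t. h (t - s)) = (\<integral>\<^sup>+t. ennreal (exp (- (l * s))) *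
        (ennreal (exp (- (l * (t - s))) * (norm (h (t - s)))\<^sup>2) * indicator {..T} t) \<partial>lborel)"
      unfolding energy_def
    proof (rule nn_integral_cong)
      fix t
      have "exp (- (l * t)) = exp (- (l * s)) * exp (- (l * (t - s)))"
        unfolding exp_add[symmetric] by (simp add: right_diff_distrib)
      then have "ennreal (exp (- (l * t)) * (norm (h (t - s)))\<^sup>2)
        = ennreal (exp (- (l * s))) * ennreal (exp (- (l * (t - s))) * (norm (h (t - s)))\<^sup>2)"
        by (metis ennreal_mult exp_ge_zero mult.assoc mult_nonneg_nonneg zero_le_power2)
      then show "ennreal (exp (- (l * t)) * (norm (h (t - s)))\<^sup>2) * indicator {..T} t = ennreal (exp (- (l * s))) *
        (ennreal (exp (- (l * (t - s))) * (norm (h (t - s)))\<^sup>2) * indicator {..T} t)"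
        by (metis mult.assoc)
    qed
    also have "\<dots> = ennreal (exp (- (l * s))) *
      (\<integral>\<^sup>+t. (ennreal (exp (- (l * (t - s))) * (norm (h (t - s)))\<^sup>2) * indicator {..T} t) \<partial>lborel)"
      by (rule nn_integral_cmult) measurable
    also have "\<dots> \<le> ennreal \<epsilon> * energy l T h"
      using l assms by (intro mult_mono energy_shift) (auto intro!: ennreal_leI)
    finally show "energy l T (\<lambda>t. h (t - s)) \<le> ennreal \<epsilon> * energy l T h" .
  qed
next
  fix l :: real
  have "\<forall>\<^sub>F \<delta> in at_right 0. \<delta> < s"
    using assms by (rule eventually_at_right_real[THEN eventually_mono]) auto
  then show "\<forall>\<^sub>F \<delta> in at_right 0. \<forall>d t. (\<forall>n. causal_L2 (d n)) \<longrightarrow>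
      (\<forall>T. (\<lambda>n. energy l T (d n)) \<longlonglongrightarrow> 0) \<longrightarrow> (\<forall>s\<le>t - \<delta>. (\<lambda>n. d n s) \<longlonglongrightarrow> 0) \<longrightarrow>
      (\<lambda>n. d n (t - s)) \<longlonglongrightarrow> (0::'a)"
  proof eventually_elim
    case (elim \<delta>)
    then show ?case by simp
  qed
qed simp

section \<open>Distributed delays\<close>

locale bounded_kernel = bounded_bilinear prod
  for prod :: "'c::euclidean_space \<Rightarrow> 'a::euclidean_space \<Rightarrow> 'b::euclidean_space" +
  fixes k :: "real \<Rightarrow> 'c" and C \<tau> :: real
  assumes kernel_measurable[measurable]: "k \<in> borel_measurable borel"
    and kernel_bound: "norm (k s) \<le> C"
    and kernel_support: "s \<notin> {-\<tau>..0} \<Longrightarrow> k s = 0"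
    and delay_pos: "0 < \<tau>"
begin

text \<open>Convolution with the reflected kernel. As \<open>k\<close> vanishes outside
  \<open>{-\<tau>..0}\<close>, the integral over the whole line equals the one over the window, and
  only the present and past of \<open>h\<close> enter.\<close>

definition conv :: "(real \<Rightarrow> 'a) \<Rightarrow> real \<Rightarrow> 'b" where
  "conv h t = (LINT s|lborel. prod (k s) (h (t + s)))"

lemma prod_measurable[measurable (raw)]:
  assumes "f \<in> borel_measurable M" "g \<in> borel_measurable M"
  shows "(\<lambda>x. prod (f x) (g x)) \<in> borel_measurable M"
  using assms by (rule borel_measurable_continuous_Pair) (intro continuous_on continuous_intros)

lemma kernel_prod_bound: "\<exists>M\<ge>0. \<forall>s x. norm (prod (k s) x) \<le> M * indicator {-\<tau>..0} s * norm x"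
proof -
  obtain B where B: "0 \<le> B" "\<And>a b. norm (prod a b) \<le> norm a * norm b * B"
    using nonneg_bounded by blast
  have C: "0 \<le> C" using kernel_bound[of 0] norm_ge_zero order_trans by blast
  have "norm (prod (k s) x) \<le> (C * B) * indicator {-\<tau>..0} s * norm x" for s x
  proof (cases "s \<in> {-\<tau>..0}")
    case True
    have "norm (prod (k s) x) \<le> norm (k s) * (norm x * B)" using B(2)[of "k s" x] by (simp add: mult.assoc)
    also have "\<dots> \<le> C * (norm x * B)" by (intro mult_right_mono kernel_bound) (simp add: B)
    finally show ?thesis using True by (simp add: ac_simps)
  qed (simp add: kernel_support zero_left)
  then show ?thesis using B C by (intro exI[of _ "C * B"]) auto
qed

lemma conv_integrable:
  assumes h: "causal_L2 h"
  shows "integrable lborel (\<lambda>s. prod (k s) (h (t + s)))"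
proof -
  obtain M where M: "0 \<le> M" "\<And>s x. norm (prod (k s) x) \<le> M * indicator {-\<tau>..0} s * norm x"
    using kernel_prod_bound by blast
  have [measurable]: "h \<in> borel_measurable borel" using h by (rule causal_L2_measurable)
  have "integrable lborel (\<lambda>s. indicator {..t} s *\<^sub>R h s)"
    using causal_L2_integrable[OF h] by (simp add: set_integrable_def)
  then have "integrable lborel (\<lambda>s. indicator {..t} (t + 1 * s) *\<^sub>R h (t + 1 * s))"
    by (rule lborel_integrable_real_affine) simp
  then have "integrable lborel (\<lambda>s. M * norm (indicator {..t} (t + 1 * s) *\<^sub>R h (t + 1 * s)))"
    by (intro integrable_mult_right integrable_norm)
  then show ?thesis
  proof (rule Bochner_Integration.integrable_bound)
    have "norm (prod (k s) (h (t + s))) \<le> M * norm (indicat_real {..t} (t + 1 * s) *\<^sub>R h (t + 1 * s))" for s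
      using M(2)[of s "h (t + s)"] M(1) by (cases "s \<le> 0"; cases "s \<in> {-\<tau>..0}") auto
    then show "AE s in lborel. norm (prod (k s) (h (t + s))) \<le> norm (M * norm (indicat_real {..t} (t + 1 * s) *\<^sub>R h (t + 1 * s)))"
      using M(1) by auto
  qed measurable
qed

lemma conv_measurable:
  assumes [measurable]: "h \<in> borel_measurable borel"
  shows "conv h \<in> borel_measurable borel"
  unfolding conv_def by measurable

text \<open>Cauchy-Schwarz on the window, with c = M^2 * \<tau>: the window indicator is written
  twice, so that one factor is a constant on the window and the other is the signal there. The
  constant is obtained before \<open>h\<close> and \<open>t\<close>, hence is uniform in
  both.\<close>

lemma conv_pointwise:
  obtains c where "0 \<le> c"
    "\<And>h t. h \<in> borel_measurable borel \<Longrightarrow> ennreal ((norm (conv h t))\<^sup>2)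
       \<le> ennreal c * (\<integral>\<^sup>+s. indicator {-\<tau>..0} s * ennreal ((norm (h (t + s)))\<^sup>2) \<partial>lborel)"
proof -
  obtain M where M: "0 \<le> M" "\<And>s x. norm (prod (k s) x) \<le> M * indicator {-\<tau>..0} s * norm x"
    using kernel_prod_bound by blast
  have "ennreal ((norm (conv h t))\<^sup>2)
       \<le> ennreal (M\<^sup>2 * \<tau>) * (\<integral>\<^sup>+s. indicator {-\<tau>..0} s * ennreal ((norm (h (t + s)))\<^sup>2) \<partial>lborel)"
    if [measurable]: "h \<in> borel_measurable borel" for h t
  proof -
    have "ennreal (norm (conv h t)) \<le> (\<integral>\<^sup>+s. ennreal (norm (prod (k s) (h (t + s)))) \<partial>lborel)"
    \<comment> \<open>If the integrand is not integrable, its Bochner integral is 0 by convention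
      and the bound is trivial.\<close>
    proof (cases "integrable lborel (\<lambda>s. prod (k s) (h (t + s)))")
      case True
      then show ?thesis unfolding conv_def by (rule integral_norm_bound_ennreal)
    qed (simp add: conv_def not_integrable_integral_eq)
    also have "\<dots> \<le> (\<integral>\<^sup>+s. (ennreal M * indicator {-\<tau>..0} s) * (indicator {-\<tau>..0} s * ennreal (norm (h (t + s)))) \<partial>lborel)"
    proof (rule nn_integral_mono)
      fix s
      show "ennreal (norm (prod (k s) (h (t + s))))
        \<le> (ennreal M * indicator {-\<tau>..0} s) * (indicator {-\<tau>..0} s * ennreal (norm (h (t + s))))"
        using M(2)[of s "h (t + s)"] M(1)
        by (auto simp flip: ennreal_mult split: split_indicator_asm split_indicator intro!: ennreal_leI)
    qed
    finally have "(ennreal (norm (conv h t)))\<^sup>2 \<le> (\<integral>\<^sup>+s. (ennreal M * indicator {-\<tau>..0} s) * (indicator {-\<tau>..0} s * ennreal (norm (h (t + s)))) \<partial>lborel)\<^sup>2"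
      by (rule power_mono) simp
    also have "\<dots> \<le> (\<integral>\<^sup>+s. (ennreal M * indicator {-\<tau>..0} s)\<^sup>2 \<partial>lborel)
        * (\<integral>\<^sup>+s. (indicator {-\<tau>..0} s * ennreal (norm (h (t + s))))\<^sup>2 \<partial>lborel)"
      by (rule Cauchy_Schwarz_nn_integral) measurable
    also have "(\<integral>\<^sup>+s. (ennreal M * indicator {-\<tau>..0} s)\<^sup>2 \<partial>lborel) = (\<integral>\<^sup>+s. ennreal (M\<^sup>2) * indicator {-\<tau>..0} s \<partial>lborel)"
      using M(1) by (intro nn_integral_cong) (auto simp: ennreal_power split: split_indicator)
    also have "\<dots> = ennreal (M\<^sup>2) * emeasure lborel {-\<tau>..0}"
      by (rule nn_integral_cmult_indicator) simp
    also have "\<dots> = ennreal (M\<^sup>2 * \<tau>)"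
      using delay_pos by (simp add: ennreal_mult)
    also have "(\<integral>\<^sup>+s. (indicator {-\<tau>..0} s * ennreal (norm (h (t + s))))\<^sup>2 \<partial>lborel)
        = (\<integral>\<^sup>+s. indicator {-\<tau>..0} s * ennreal ((norm (h (t + s)))\<^sup>2) \<partial>lborel)"
      by (intro nn_integral_cong) (auto simp: ennreal_power split: split_indicator)
    finally show ?thesis by (simp add: ennreal_power)
  qed
  moreover have "0 \<le> M\<^sup>2 * \<tau>" using delay_pos by simp
  ultimately show ?thesis using that by blast
qed

lemma nn_integral_exp_window:
  assumes "0 < l"
  shows "(\<integral>\<^sup>+s. indicator {-\<tau>..0} s * ennreal (exp (l * s)) \<partial>lborel) \<le> ennreal (1 / l)"
proof -
  have "(\<integral>\<^sup>+s. ennreal (exp (l * s)) * indicator {-\<tau>..0} s \<partial>lborel) = ennreal (exp (l * 0) / l - exp (l * (-\<tau>)) / l)"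
    by (rule nn_integral_FTC_Icc)
       (use assms delay_pos in \<open>auto intro!: derivative_eq_intros\<close>)
  also have "\<dots> \<le> ennreal (1 / l)"
    using assms by (intro ennreal_leI) simp
  finally show ?thesis by (simp add: mult.commute)
qed

text \<open>The weight is split as exp(-l t) = exp(l s) * exp(-l (t + s)). After exchanging the
  integrals, the inner one is the energy of a delayed signal, at most \<open>energy l T h\<close>,
  and the integral of exp(l s) over the window is at most 1 / l. That last integral is the source of
  the gain for large l.\<close>

lemma conv_energy:
  obtains c where "0 \<le> c"
    "\<And>h l T. h \<in> borel_measurable borel \<Longrightarrow> 0 < l \<Longrightarrow> energy l T (conv h) \<le> ennreal (c / l) * energy l T h"
proof -
  obtain c where c: "0 \<le> c" "\<And>h t. h \<in> borel_measurable borel \<Longrightarrow> ennreal ((norm (conv h t))\<^sup>2)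
       \<le> ennreal c * (\<integral>\<^sup>+s. indicator {-\<tau>..0} s * ennreal ((norm (h (t + s)))\<^sup>2) \<partial>lborel)"
    using conv_pointwise by blast
  have "energy l T (conv h) \<le> ennreal (c / l) * energy l T h"
    if [measurable]: "h \<in> borel_measurable borel" and l: "0 < l" for h l T
  proof -
    define e where "e t s = ennreal (exp (- (l * (t + s))) * (norm (h (t + s)))\<^sup>2) * indicator {..T} t" for t s
    have [measurable]: "case_prod e \<in> borel_measurable (lborel \<Otimes>\<^sub>M lborel)"
      unfolding e_def by measurable
    have split: "ennreal (exp (- (l * t)) * a) = ennreal (exp (l * s)) * ennreal (exp (- (l * (t + s))) * a)"
      if "0 \<le> a" for t s a
    proof -
      have "exp (- (l * t)) = exp (l * s) * exp (- (l * (t + s)))"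
        unfolding exp_add[symmetric] by (simp add: distrib_left)
      then show ?thesis
        using that by (metis ennreal_mult exp_ge_zero mult.assoc mult_nonneg_nonneg)
    qed
    have "energy l T (conv h) \<le> (\<integral>\<^sup>+t. (\<integral>\<^sup>+s. ennreal c * (indicator {-\<tau>..0} s * ennreal (exp (l * s)) * e t s) \<partial>lborel) \<partial>lborel)"
      unfolding energy_def
    proof (rule nn_integral_mono)
      fix t
      have "ennreal (exp (- (l * t)) * (norm (conv h t))\<^sup>2) * indicator {..T} t
         \<le> ennreal (exp (- (l * t))) * (ennreal c * (\<integral>\<^sup>+s. indicator {-\<tau>..0} s * ennreal ((norm (h (t + s)))\<^sup>2) \<partial>lborel)) * indicator {..T} t"
        using c(2)[of h t] by (simp add: ennreal_mult mult_left_mono split: split_indicator)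
      also have "\<dots> = (\<integral>\<^sup>+s. (ennreal (exp (- (l * t))) * ennreal c * indicator {..T} t) *
           (indicator {-\<tau>..0} s * ennreal ((norm (h (t + s)))\<^sup>2)) \<partial>lborel)"
        by (subst nn_integral_cmult) (simp_all add: ac_simps)
      also have "\<dots> = (\<integral>\<^sup>+s. ennreal c * (indicator {-\<tau>..0} s * ennreal (exp (l * s)) * e t s) \<partial>lborel)"
      proof (rule nn_integral_cong)
        fix s
        have "ennreal (exp (- (l * t))) * ennreal ((norm (h (t + s)))\<^sup>2)
          = ennreal (exp (l * s)) * ennreal (exp (- (l * (t + s))) * (norm (h (t + s)))\<^sup>2)"
          using split[of "(norm (h (t + s)))\<^sup>2" t s] by (simp add: ennreal_mult)
        then show "(ennreal (exp (- (l * t))) * ennreal c * indicator {..T} t) *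
           (indicator {-\<tau>..0} s * ennreal ((norm (h (t + s)))\<^sup>2))
           = ennreal c * (indicator {-\<tau>..0} s * ennreal (exp (l * s)) * e t s)"
          unfolding e_def by (cases "s \<in> {-\<tau>..0}"; cases "t \<le> T") (simp_all add: ac_simps)
      qed
      finally show "ennreal (exp (- (l * t)) * (norm (conv h t))\<^sup>2) * indicator {..T} t
        \<le> (\<integral>\<^sup>+s. ennreal c * (indicator {-\<tau>..0} s * ennreal (exp (l * s)) * e t s) \<partial>lborel)" .
    qed
    also have "\<dots> = (\<integral>\<^sup>+s. (\<integral>\<^sup>+t. ennreal c * (indicator {-\<tau>..0} s * ennreal (exp (l * s)) * e t s) \<partial>lborel) \<partial>lborel)"
      by (rule lborel_pair.Fubini') measurable
    also have "\<dots> \<le> (\<integral>\<^sup>+s. ennreal c * (indicator {-\<tau>..0} s * ennreal (exp (l * s))) * energy l T h \<partial>lborel)"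
    proof (rule nn_integral_mono)
      fix s
      have "(\<integral>\<^sup>+t. ennreal c * (indicator {-\<tau>..0} s * ennreal (exp (l * s)) * e t s) \<partial>lborel)
        = ennreal c * (indicator {-\<tau>..0} s * ennreal (exp (l * s))) * (\<integral>\<^sup>+t. e t s \<partial>lborel)"
        by (subst nn_integral_cmult[symmetric]) (simp_all add: mult.assoc)
      also have "\<dots> \<le> ennreal c * (indicator {-\<tau>..0} s * ennreal (exp (l * s))) * energy l T h"
        using energy_shift[of h "-s" l T] by (auto simp: e_def split: split_indicator intro!: mult_left_mono)
      finally show "(\<integral>\<^sup>+t. ennreal c * (indicator {-\<tau>..0} s * ennreal (exp (l * s)) * e t s) \<partial>lborel)
        \<le> ennreal c * (indicator {-\<tau>..0} s * ennreal (exp (l * s))) * energy l T h" .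
    qed
    also have "\<dots> = ennreal c * (\<integral>\<^sup>+s. indicator {-\<tau>..0} s * ennreal (exp (l * s)) \<partial>lborel) * energy l T h"
      by (simp add: nn_integral_cmult nn_integral_multc)
    also have "\<dots> \<le> ennreal c * ennreal (1 / l) * energy l T h"
      using nn_integral_exp_window[OF l] by (intro mult_mono) auto
    also have "\<dots> = ennreal (c / l) * energy l T h"
      using c(1) l by (simp flip: ennreal_mult)
    finally show ?thesis .
  qed
  with c(1) show ?thesis using that by blast
qed

text \<open>Fubini in (s, r), where r is the variable of the primitive: for fixed s \<le> 0 the
  integral over r is the primitive of a delayed signal, which is a delayed primitive by
  \<open>primitive_shift\<close>.\<close>

lemma conv_primitive:
  assumes h: "causal_L2 h"
  shows "conv (primitive h) t = primitive (conv h) t"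
proof -
  obtain M where M: "0 \<le> M" "\<And>s x. norm (prod (k s) x) \<le> M * indicator {-\<tau>..0} s * norm x"
    using kernel_prod_bound by blast
  have [measurable]: "h \<in> borel_measurable borel" using h by (rule causal_L2_measurable)
  define f where "f s r = prod (k s) (indicat_real {0..t} r *\<^sub>R h (r + s))" for s r
  have [measurable]: "case_prod f \<in> borel_measurable (lborel \<Otimes>\<^sub>M lborel)"
    unfolding f_def by measurable
  have int: "integrable lborel (\<lambda>r. indicat_real {0..t} r *\<^sub>R h (r + s))" if "s \<le> 0" for s
  proof -
    have "integrable lborel (\<lambda>r. indicat_real {s..t + s} (s + 1 * r) *\<^sub>R h (s + 1 * r))"
      using causal_L2_integrable_subset[OF h, of "{s..t+s}" "t+s"]
      by (intro lborel_integrable_real_affine) (auto simp: set_integrable_def)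
    moreover have "indicat_real {s..t + s} (s + 1 * r) *\<^sub>R h (s + 1 * r) = indicat_real {0..t} r *\<^sub>R h (r + s)" for r
      by (auto simp: add.commute split: split_indicator)
    ultimately show ?thesis by simp
  qed
  \<comment> \<open>With r \<le> t and s \<le> 0 only the values of \<open>h\<close> up to time t
    are met, which gives a bound uniform in s over the bounded window, hence integrability on the
    product.\<close>
  have Lr: "(LINT r|lborel. norm (f s r)) \<le> indicator {-\<tau>..0} s * (M * (LINT r|lborel. norm (indicat_real {..t} r *\<^sub>R h r)))" for s
  proof (cases "s \<in> {-\<tau>..0}")
    case True
    then have s: "s \<le> 0" by simp
    have i: "integrable lborel (\<lambda>r. indicat_real {..t} r *\<^sub>R h r)"
      using causal_L2_integrable[OF h] by (simp add: set_integrable_def)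
    have i': "integrable lborel (\<lambda>r. indicat_real {..t} (s + 1 * r) *\<^sub>R h (s + 1 * r))"
      using i by (rule lborel_integrable_real_affine) simp
    have "(LINT r|lborel. norm (f s r)) \<le> (LINT r|lborel. M * norm (indicat_real {..t} (s + 1 * r) *\<^sub>R h (s + 1 * r)))"
    proof (rule integral_mono_AE')
      show "integrable lborel (\<lambda>r. M * norm (indicat_real {..t} (s + 1 * r) *\<^sub>R h (s + 1 * r)))"
        by (intro integrable_mult_right integrable_norm i')
      have "norm (f s r) \<le> M * norm (indicat_real {..t} (s + 1 * r) *\<^sub>R h (s + 1 * r))" for r
        using M(2)[of s "indicat_real {0..t} r *\<^sub>R h (r + s)"] s True M(1)
        by (auto simp: f_def add.commute zero_right split: split_indicator_asm split_indicator)
      then show "AE r in lborel. norm (f s r) \<le> M * norm (indicat_real {..t} (s + 1 * r) *\<^sub>R h (s + 1 * r))"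
        by simp
    qed (use M(1) in simp)
    also have "\<dots> = M * (LINT r|lborel. norm (indicat_real {..t} r *\<^sub>R h r))"
      by (subst (2) lborel_integral_real_affine[where c=1 and t=s]) simp_all
    finally show ?thesis using True by simp
  qed (simp add: f_def kernel_support zero_left)
  have fint: "integrable lborel (\<lambda>r. f s r)" for s
  proof (cases "s \<in> {-\<tau>..0}")
    case True
    then show ?thesis unfolding f_def
      by (intro integrable_bounded_linear[OF bounded_linear_right] int) simp
  qed (simp add: f_def kernel_support zero_left)
  have "integrable (lborel \<Otimes>\<^sub>M lborel) (case_prod f)"
  proof (rule lborel_pair.Fubini_integrable)
    show "integrable lborel (\<lambda>x. LINT y|lborel. norm (case_prod f (x, y)))"
    proof (rule Bochner_Integration.integrable_bound)
      show "integrable lborel (\<lambda>s. indicat_real {-\<tau>..0} s * (M * (LINT r|lborel. norm (indicat_real {..t} r *\<^sub>R h r))))"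
        by (intro integrable_mult_left integrable_real_indicator) (auto simp: emeasure_lborel_Icc_eq)
      show "AE s in lborel. norm (LINT y|lborel. norm (case_prod f (s, y)))
        \<le> norm (indicat_real {-\<tau>..0} s * (M * (LINT r|lborel. norm (indicat_real {..t} r *\<^sub>R h r))))"
        using Lr M(1) by (auto simp: abs_mult Bochner_Integration.integral_nonneg)
    qed measurable
  qed (use fint in auto)
  then have "(LINT r|lborel. (LINT s|lborel. f s r)) = (LINT s|lborel. (LINT r|lborel. f s r))"
    by (rule lborel_pair.Fubini_integral)
  moreover have "(LINT r|lborel. (LINT s|lborel. f s r)) = primitive (conv h) t"
    unfolding primitive_def conv_def set_lebesgue_integral_def f_def
    by (intro Bochner_Integration.integral_cong) (auto simp: scaleR_right zero_right split: split_indicator)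
  moreover have "(LINT s|lborel. (LINT r|lborel. f s r)) = conv (primitive h) t"
    unfolding conv_def
  proof (intro Bochner_Integration.integral_cong refl)
    fix s
    show "(LINT r|lborel. f s r) = prod (k s) (primitive h (t + s))"
    proof (cases "s \<in> {-\<tau>..0}")
      case True
      then have "s \<le> 0" by simp
      have "(LINT r|lborel. f s r) = prod (k s) (LINT r|lborel. indicat_real {0..t} r *\<^sub>R h (r + s))"
        unfolding f_def by (rule integral_bounded_linear[OF bounded_linear_right int]) fact
      also have "(LINT r|lborel. indicat_real {0..t} r *\<^sub>R h (r + s)) = primitive h (t + s)"
        using primitive_shift[OF h, of "-s" t] \<open>s \<le> 0\<close> by (simp add: primitive_def set_lebesgue_integral_def)
      finally show ?thesis .
    qed (simp add: f_def kernel_support zero_left)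
  qed
  ultimately show ?thesis by simp
qed

lemma conv_neg:
  assumes "causal_L2 h" "t < 0"
  shows "conv h t = 0"
proof -
  have "prod (k s) (h (t + s)) = 0" for s
    using causal_L2_neg[OF assms(1), of "t + s"] assms(2)
    by (cases "s \<in> {-\<tau>..0}") (auto simp: zero_right kernel_support zero_left)
  then show ?thesis by (simp add: conv_def)
qed

text \<open>The window ending at t lies in the half-line up to t, where the weight is at least
  exp(-l t); so \<open>energy l t\<close> controls the value of the convolution at the point t
  itself. Convergence of energies thus implies pointwise convergence, and in
  \<open>memory_op_conv\<close> every \<delta> is admissible.\<close>

lemma conv_tendsto:
  assumes d: "\<And>n. causal_L2 (d n)" and l: "0 \<le> l" and lim: "(\<lambda>n. energy l t (d n)) \<longlonglongrightarrow> 0"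
  shows "(\<lambda>n. conv (d n) t) \<longlonglongrightarrow> 0"
proof -
  obtain c where c: "0 \<le> c" "\<And>h t. h \<in> borel_measurable borel \<Longrightarrow> ennreal ((norm (conv h t))\<^sup>2)
       \<le> ennreal c * (\<integral>\<^sup>+s. indicator {-\<tau>..0} s * ennreal ((norm (h (t + s)))\<^sup>2) \<partial>lborel)"
    using conv_pointwise by blast
  have bound: "ennreal ((norm (conv (d n) t))\<^sup>2) \<le> ennreal (c * exp (l * t)) * energy l t (d n)" for n
  proof -
    have [measurable]: "d n \<in> borel_measurable borel" using d by (rule causal_L2_measurable)
    have "(\<integral>\<^sup>+s. indicator {-\<tau>..0} s * ennreal ((norm (d n (t + s)))\<^sup>2) \<partial>lborel)
       \<le> (\<integral>\<^sup>+s. indicator {..t} (t + 1 * s) * ennreal ((norm (d n (t + 1 * s)))\<^sup>2) \<partial>lborel)"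
      by (intro nn_integral_mono) (auto split: split_indicator)
    also have "\<dots> = (\<integral>\<^sup>+s. indicator {..t} s * ennreal ((norm (d n s))\<^sup>2) \<partial>lborel)"
      by (subst (2) nn_integral_real_affine[where c=1 and t=t]) simp_all
    also have "\<dots> = energy 0 t (d n)"
      unfolding energy_def by (intro nn_integral_cong) (simp add: mult.commute)
    also have "\<dots> \<le> ennreal (exp (l * t)) * energy l t (d n)"
      by (rule unweighted_le_energy) (use l in auto)
    finally have "ennreal ((norm (conv (d n) t))\<^sup>2) \<le> ennreal c * (ennreal (exp (l * t)) * energy l t (d n))"
      by (intro order_trans[OF c(2) mult_left_mono]) simp_all
    then show ?thesis using c(1) by (simp add: ennreal_mult mult.assoc)
  qed
  have "(\<lambda>n. ennreal (c * exp (l * t)) * energy l t (d n)) \<longlonglongrightarrow> ennreal (c * exp (l * t)) * 0"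
    using lim by (intro ennreal_tendsto_cmult) auto
  then have upper: "(\<lambda>n. ennreal (c * exp (l * t)) * energy l t (d n)) \<longlonglongrightarrow> 0" by simp
  have "(\<lambda>n. ennreal ((norm (conv (d n) t))\<^sup>2)) \<longlonglongrightarrow> 0"
    by (rule tendsto_sandwich[OF _ _ tendsto_const upper]) (simp_all add: bound always_eventually)
  then have "(\<lambda>n. ennreal ((norm (conv (d n) t))\<^sup>2)) \<longlonglongrightarrow> ennreal 0" by simp
  then have "(\<lambda>n. (norm (conv (d n) t))\<^sup>2) \<longlonglongrightarrow> 0"
    by (subst (asm) tendsto_ennreal_iff) auto
  then have "(\<lambda>n. sqrt ((norm (conv (d n) t))\<^sup>2)) \<longlonglongrightarrow> sqrt 0"
    by (rule tendsto_real_sqrt)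
  then have "(\<lambda>n. norm (conv (d n) t)) \<longlonglongrightarrow> 0" by simp
  then show ?thesis
    by (rule tendsto_norm_zero_cancel)
qed

lemma memory_op_conv: "memory_op conv"
proof (rule memory_opI)
  fix f g :: "real \<Rightarrow> 'a" and t :: real assume "causal_L2 f" "causal_L2 g"
  then show "conv (\<lambda>t. f t + g t) t = conv f t + conv g t"
    by (simp add: conv_def add_right conv_integrable)
next
  fix \<epsilon> :: real assume "0 < \<epsilon>"
  obtain c where c: "0 \<le> c"
    "\<And>h l T. h \<in> borel_measurable borel \<Longrightarrow> 0 < l \<Longrightarrow> energy l T (conv h) \<le> ennreal (c / l) * energy l T h"
    using conv_energy by blast
  have "((\<lambda>l. c / l) \<longlongrightarrow> 0) at_top"
    by (intro tendsto_divide_0[OF tendsto_const] filterlim_at_top_imp_at_infinity filterlim_ident)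
  then have "\<forall>\<^sub>F l in at_top. c / l < \<epsilon>"
    using \<open>0 < \<epsilon>\<close> by (rule order_tendstoD)
  then show "\<forall>\<^sub>F l in at_top. \<forall>h T. causal_L2 h \<longrightarrow> energy l T (conv h) \<le> ennreal \<epsilon> * energy l T h"
    using eventually_gt_at_top[of 0]
  proof (eventually_elim, intro allI impI)
    fix l T and h :: "real \<Rightarrow> 'a" assume l: "c / l < \<epsilon>" "0 < l" and h: "causal_L2 h"
    have "energy l T (conv h) \<le> ennreal (c / l) * energy l T h"
      by (rule c(2)[OF causal_L2_measurable[OF h] l(2)])
    also have "\<dots> \<le> ennreal \<epsilon> * energy l T h"
      using l by (intro mult_right_mono ennreal_leI) auto
    finally show "energy l T (conv h) \<le> ennreal \<epsilon> * energy l T h" .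
  qed
next
  fix l :: real assume "0 \<le> l"
  then show "\<forall>\<^sub>F \<delta> in at_right 0. \<forall>d t. (\<forall>n. causal_L2 (d n)) \<longrightarrow>
      (\<forall>T. (\<lambda>n. energy l T (d n)) \<longlonglongrightarrow> 0) \<longrightarrow> (\<forall>s\<le>t - \<delta>. (\<lambda>n. d n s) \<longlonglongrightarrow> 0) \<longrightarrow>
      (\<lambda>n. conv (d n) t) \<longlonglongrightarrow> 0"
    using conv_tendsto by (intro always_eventually allI impI) blast
qed (auto simp: conv_neg conv_primitive conv_measurable causal_L2_measurable)

end

section \<open>The fixed point equation\<close>

lemma suminf_ennreal_half_powers: "(\<Sum>k. ennreal ((1 / 2) ^ k)) = 2"
proof -
  have "(\<Sum>k. ennreal ((1 / 2) ^ k)) = ennreal (\<Sum>k. (1 / 2) ^ k)"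
    by (rule suminf_ennreal2) (simp_all add: summable_geometric)
  also have "(\<Sum>k. (1 / 2 :: real) ^ k) = 2"
    by (subst suminf_geometric) simp_all
  finally show ?thesis by simp
qed

text \<open>Termwise a \<le> 2^(-k) + 2^k a^2, a consequence of (1 - 2^k a)^2 \<ge> 0; the constant
  2 is the sum of 2^(-k). It derives absolute convergence of a series from finiteness of the
  weighted sum of squares.\<close>

lemma suminf_norm_le:
  fixes a :: "nat \<Rightarrow> real"
  assumes a: "\<And>k. 0 \<le> a k"
  shows "(\<Sum>k. ennreal (a k)) \<le> 2 + (\<Sum>k. ennreal (2 ^ k * (a k)\<^sup>2))"
proof -
  have "a k \<le> (1 / 2) ^ k + 2 ^ k * (a k)\<^sup>2" for k
  proof -
    have "0 \<le> (1 - 2 ^ k * a k)\<^sup>2" by simp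
    then have "2 * (2 ^ k * a k) \<le> 1 + 2 ^ k * (2 ^ k * (a k)\<^sup>2)"
      by (simp add: power2_eq_square algebra_simps)
    moreover have "0 \<le> 2 ^ k * a k" using a by simp
    ultimately have "2 ^ k * a k \<le> 2 ^ k * ((1 / 2) ^ k + 2 ^ k * (a k)\<^sup>2)"
      by (simp add: distrib_left power_one_over)
    then show ?thesis by simp
  qed
  then have "(\<Sum>k. ennreal (a k)) \<le> (\<Sum>k. ennreal ((1 / 2) ^ k) + ennreal (2 ^ k * (a k)\<^sup>2))"
    by (intro suminf_le summableI) (simp flip: ennreal_plus add: ennreal_leI)
  also have "\<dots> = (\<Sum>k. ennreal ((1 / 2) ^ k)) + (\<Sum>k. ennreal (2 ^ k * (a k)\<^sup>2))"
    by (intro suminf_add[symmetric] summableI)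
  finally show ?thesis by (simp only: suminf_ennreal_half_powers)
qed

text \<open>Cauchy-Schwarz with weights 2^(-k), whose sum is the factor 2. With s the whole sum, 2 s
  a \<le> 2^(-k) s^2 / 2 + 2 * 2^k a^2 for each term; summing gives 2 s^2 \<le> s^2 + 2 Q, where Q
  is the weighted sum of squares.\<close>

lemma suminf_square_le:
  fixes a :: "nat \<Rightarrow> real"
  assumes a: "\<And>k. 0 \<le> a k" and "summable a" and Q: "summable (\<lambda>k. 2 ^ k * (a k)\<^sup>2)"
  shows "(\<Sum>k. a k)\<^sup>2 \<le> 2 * (\<Sum>k. 2 ^ k * (a k)\<^sup>2)"
proof -
  define s where "s = (\<Sum>k. a k)"
  have s: "0 \<le> s" unfolding s_def using assms by (intro suminf_nonneg)
  have le: "2 * s * a k \<le> (1 / 2) ^ k * (s\<^sup>2 / 2) + 2 * (2 ^ k * (a k)\<^sup>2)" for k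
  proof -
    have "0 \<le> (s - 2 * 2 ^ k * a k)\<^sup>2" by simp
    then have "2 ^ k * (2 * s * a k) \<le> 2 ^ k * ((1 / 2) ^ k * (s\<^sup>2 / 2) + 2 * (2 ^ k * (a k)\<^sup>2))"
      by (simp add: power2_eq_square algebra_simps power_one_over)
    then show ?thesis by simp
  qed
  have g: "summable (\<lambda>k. (1 / 2 :: real) ^ k)" by (simp add: summable_geometric)
  have "2 * s * s = (\<Sum>k. 2 * s * a k)"
    unfolding s_def using \<open>summable a\<close> by (simp add: suminf_mult)
  also have "\<dots> \<le> (\<Sum>k. (1 / 2) ^ k * (s\<^sup>2 / 2) + 2 * (2 ^ k * (a k)\<^sup>2))"
    by (intro suminf_le le summable_mult summable_add summable_mult2 \<open>summable a\<close> Q g)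
  also have "\<dots> = (\<Sum>k. (1 / 2) ^ k * (s\<^sup>2 / 2)) + (\<Sum>k. 2 * (2 ^ k * (a k)\<^sup>2))"
    by (intro suminf_add[symmetric] summable_mult summable_mult2 Q g)
  also have "(\<Sum>k. (1 / 2) ^ k * (s\<^sup>2 / 2)) = s\<^sup>2"
    using suminf_mult2[OF g, of "s\<^sup>2 / 2"] by (simp add: suminf_geometric)
  also have "(\<Sum>k. 2 * (2 ^ k * (a k)\<^sup>2)) = 2 * (\<Sum>k. 2 ^ k * (a k)\<^sup>2)"
    by (rule suminf_mult[OF Q])
  finally show ?thesis by (simp add: s_def power2_eq_square)
qed

text \<open>A regularity statement: \<open>c\<close> is given, and the task is to find its density.
  Formally that density solves the differentiated equation h = b + \<Phi> h, whose Neumann series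
  has the terms \<open>H k\<close>; the terms \<open>D k\<close> are the remainders that separate
  \<open>c\<close> from the partial sums of the primitives.\<close>

theorem memory_op_fixpoint_primitive:
  fixes \<Phi> :: "(real \<Rightarrow> 'a::euclidean_space) \<Rightarrow> real \<Rightarrow> 'a"
  assumes \<Phi>: "memory_op \<Phi>" and c: "causal_L2 c" and b: "causal_L2 b"
    and eq: "\<And>t. c t = primitive b t + \<Phi> c t"
  shows "\<exists>h. causal_L2 h \<and> c = primitive h"
proof -
  define H where "H k = (\<Phi> ^^ k) b" for k
  define D where "D k = (\<Phi> ^^ k) c" for k
  have H: "causal_L2 (H k)" for k
    by (induction k) (auto simp: H_def b intro: memory_op_causal_L2[OF \<Phi>])
  have D: "causal_L2 (D k)" for k
    by (induction k) (auto simp: D_def c intro: memory_op_causal_L2[OF \<Phi>])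
  have [measurable]: "H k \<in> borel_measurable borel" for k
    using H by (rule causal_L2_measurable)
  have "\<forall>\<^sub>F l in at_top. (\<forall>h T. causal_L2 h \<longrightarrow> energy l T (\<Phi> h) \<le> ennreal (1/4) * energy l T h) \<and> 0 \<le> l"
    using memory_op_energy[OF \<Phi>, of "1/4"] eventually_ge_at_top[of "0::real"] by (auto intro: eventually_conj)
  \<comment> \<open>The factor 1/4, rather than any number below 1, leaves room for the weights 2^k
    used below: 2^k * (1/4)^k = (1/2)^k is still summable.\<close>
  then obtain l :: real where l: "0 \<le> l"
    and contr: "\<And>h T. causal_L2 h \<Longrightarrow> energy l T (\<Phi> h) \<le> ennreal (1/4) * energy l T h"
    by (auto dest!: eventually_happens)
  have iter: "energy l T ((\<Phi> ^^ k) g) \<le> ennreal ((1/4) ^ k) * energy l T g" if g: "causal_L2 g" for g T k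
  proof (induction k)
    case (Suc k)
    have "causal_L2 ((\<Phi> ^^ k) g)"
      by (induction k) (auto simp: g intro: memory_op_causal_L2[OF \<Phi>])
    then have "energy l T ((\<Phi> ^^ Suc k) g) \<le> ennreal (1/4) * energy l T ((\<Phi> ^^ k) g)"
      by (simp add: contr del: ennreal_less_one_iff)
    also have "\<dots> \<le> ennreal (1/4) * (ennreal ((1/4) ^ k) * energy l T g)"
      by (intro mult_left_mono Suc) simp
    also have "\<dots> = ennreal ((1/4) ^ Suc k) * energy l T g"
      by (simp add: mult.assoc[symmetric] ennreal_mult[symmetric])
    finally show ?case .
  qed simp
  \<comment> \<open>This is \<open>\<Phi>\<close> iterated n times on the given equation. The claim
    is kept general in t because the next application of \<open>\<Phi>\<close> needs an equality of
    functions.\<close>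
  have expand: "D n t = primitive (H n) t + D (Suc n) t" for n t
  proof (induction n arbitrary: t)
    case 0
    then show ?case by (simp add: D_def H_def eq[symmetric])
  next
    case (Suc n)
    have "D n = (\<lambda>t. primitive (H n) t + D (Suc n) t)"
      by (rule ext) (rule Suc)
    then have "D (Suc n) t = \<Phi> (\<lambda>t. primitive (H n) t + D (Suc n) t) t"
      unfolding D_def by (metis funpow.simps(2) o_apply)
    moreover have "\<Phi> (\<lambda>t. primitive (H n) t + D (Suc n) t) t = \<Phi> (primitive (H n)) t + \<Phi> (D (Suc n)) t"
      by (rule memory_op_plus[OF \<Phi> causal_L2_primitive[OF H] D])
    moreover have "\<Phi> (primitive (H n)) t = primitive (H (Suc n)) t"
      using memory_op_primitive[OF \<Phi> H, of n t] by (simp add: H_def)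
    moreover have "\<Phi> (D (Suc n)) t = D (Suc (Suc n)) t"
      by (simp add: D_def)
    ultimately show ?case by simp
  qed
  have c_eq: "c t = (\<Sum>k<n. primitive (H k) t) + D n t" for n t
  proof (induction n)
    case 0
    show ?case by (simp add: D_def)
  next
    case (Suc n)
    then show ?case using expand[of n t] by (simp add: add.assoc)
  qed
  have D_energy: "(\<lambda>n. energy l T (D n)) \<longlonglongrightarrow> 0" for T
  proof -
    have "(\<lambda>n. ennreal ((1/4) ^ n)) \<longlonglongrightarrow> ennreal 0"
      by (intro tendsto_ennrealI LIMSEQ_power_zero) simp
    then have "(\<lambda>n. energy l T c * ennreal ((1/4) ^ n)) \<longlonglongrightarrow> energy l T c * ennreal 0"
      using causal_L2_energy_finite[OF c l, of T] by (intro ennreal_tendsto_cmult) auto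
    then have "(\<lambda>n. ennreal ((1/4) ^ n) * energy l T c) \<longlonglongrightarrow> 0" by (simp add: mult.commute)
    then show ?thesis
      unfolding D_def
      by (rule tendsto_sandwich[OF _ _ tendsto_const, rotated 2])
         (simp_all add: iter[OF c] always_eventually)
  qed
  define R where "R \<delta> \<longleftrightarrow> (\<forall>d t. (\<forall>n. causal_L2 (d n)) \<longrightarrow> (\<forall>T. (\<lambda>n. energy l T (d n)) \<longlonglongrightarrow> 0) \<longrightarrow>
        (\<forall>s\<le>t - \<delta>. (\<lambda>n. d n s) \<longlonglongrightarrow> 0) \<longrightarrow> (\<lambda>n. \<Phi> (d n) t) \<longlonglongrightarrow> 0)" for \<delta>
  have "\<forall>\<^sub>F \<delta> in at_right 0. R \<delta>"
    unfolding R_def by (rule memory_op_tendsto[OF \<Phi> l])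
  then have "\<forall>\<^sub>F \<delta> in at_right 0. R \<delta> \<and> 0 < \<delta>"
    using eventually_at_right_less by (rule eventually_conj)
  then obtain \<delta> :: real where \<delta>: "0 < \<delta>" and step: "R \<delta>"
    using eventually_happens trivial_limit_at_right_real by blast
  \<comment> \<open>Pointwise convergence advances by \<delta> at each step: on t < (j + 1) *
    \<delta> the operator looks at point values only where t - \<delta> < j * \<delta>, and the
    energies tend to 0 anyway. The strict inequality lets the case j = 0 be causality.\<close>
  have D_lim_step: "\<forall>t < real j * \<delta>. (\<lambda>n. D n t) \<longlonglongrightarrow> 0" for j
  proof (induction j)
    case 0
    then show ?case using causal_L2_neg[OF D] by simp
  next
    case (Suc j)
    show ?case
    proof (intro allI impI)
      fix t assume "t < real (Suc j) * \<delta>"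
      then have "\<forall>s\<le>t - \<delta>. (\<lambda>n. D n s) \<longlonglongrightarrow> 0"
        using Suc by (auto simp: algebra_simps)
      then have "(\<lambda>n. \<Phi> (D n) t) \<longlonglongrightarrow> 0"
        using step D D_energy unfolding R_def by blast
      then have "(\<lambda>n. D (Suc n) t) \<longlonglongrightarrow> 0" by (simp add: D_def)
      then show "(\<lambda>n. D n t) \<longlonglongrightarrow> 0" by (rule LIMSEQ_imp_Suc)
    qed
  qed
  have D_lim: "(\<lambda>n. D n t) \<longlonglongrightarrow> 0" for t
  proof -
    obtain j where "t < real j * \<delta>" using reals_Archimedean3[OF \<delta>] by blast
    then show ?thesis using D_lim_step by blast
  qed
  have c_sums: "(\<lambda>k. primitive (H k) t) sums c t" for t
  proof -
    have "(\<Sum>k<n. primitive (H k) t) = c t - D n t" for n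
      using c_eq[of t n] by simp
    then show ?thesis
      unfolding sums_def using tendsto_diff[OF tendsto_const D_lim, of "c t" t] by simp
  qed

  \<comment> \<open>One weighted square function serves two purposes: where it is finite the series
    of the \<open>H k\<close> converges absolutely, and it dominates the square of the sum. This
    replaces an appeal to completeness of the space.\<close>
  define S where "S t = (\<Sum>k. ennreal (2 ^ k * (norm (H k t))\<^sup>2))" for t
  have [measurable]: "S \<in> borel_measurable borel" unfolding S_def by measurable
  have S_fin: "(\<integral>\<^sup>+t. S t * indicator {..T} t \<partial>lborel) < \<infinity>" for T
  proof -
    have "(\<integral>\<^sup>+t. S t * indicator {..T} t \<partial>lborel) = (\<integral>\<^sup>+t. (\<Sum>k. ennreal (2 ^ k) * (ennreal (exp (- (0 * t)) * (norm (H k t))\<^sup>2) * indicator {..T} t)) \<partial>lborel)"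
      unfolding S_def by (intro nn_integral_cong) (simp add: ennreal_mult ennreal_suminf_multc mult.assoc split: split_indicator)
    also have "\<dots> = (\<Sum>k. ennreal (2 ^ k) * energy 0 T (H k))"
      unfolding energy_def by (subst nn_integral_suminf, measurable, subst nn_integral_cmult) measurable
    also have "\<dots> \<le> (\<Sum>k. ennreal ((1/2) ^ k) * (ennreal (exp (l * T)) * energy l T b))"
    proof (intro suminf_le summableI)
      fix k
      have "energy 0 T (H k) \<le> ennreal (exp (l * T)) * energy l T (H k)"
        by (rule unweighted_le_energy) (simp_all add: l)
      also have "\<dots> \<le> ennreal (exp (l * T)) * (ennreal ((1/4) ^ k) * energy l T b)"
        unfolding H_def by (intro mult_left_mono iter[OF b]) simp
      finally have "energy 0 T (H k) \<le> ennreal (exp (l * T)) * (ennreal ((1/4) ^ k) * energy l T b)" .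
      then have "ennreal (2 ^ k) * energy 0 T (H k) \<le> ennreal (2 ^ k) * (ennreal (exp (l * T)) * (ennreal ((1/4) ^ k) * energy l T b))"
        by (rule mult_left_mono) simp
      also have "\<dots> = (ennreal (2 ^ k) * ennreal ((1/4) ^ k)) * (ennreal (exp (l * T)) * energy l T b)"
        by (simp add: ac_simps)
      also have "ennreal (2 ^ k) * ennreal ((1/4) ^ k) = ennreal ((1/2) ^ k)"
        by (simp flip: ennreal_mult power_mult_distrib)
      finally show "ennreal (2 ^ k) * energy 0 T (H k) \<le> ennreal ((1/2) ^ k) * (ennreal (exp (l * T)) * energy l T b)" .
    qed
    also have "\<dots> = 2 * (ennreal (exp (l * T)) * energy l T b)"
      unfolding ennreal_suminf_multc suminf_ennreal_half_powers ..
    also have "\<dots> < \<infinity>"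
      using causal_L2_energy_finite[OF b l, of T] by (simp add: ennreal_mult_less_top)
    finally show ?thesis .
  qed
  have norm_S: "(\<Sum>k. ennreal (norm (H k t))) \<le> 2 + S t" for t
    unfolding S_def by (rule suminf_norm_le) simp
  have S_AE: "AE t in lborel. S t < \<infinity>"
  proof -
    \<comment> \<open>Finiteness is available on each half-line separately; integer horizons reduce
      the claim to countably many null sets.\<close>
    have "AE t in lborel. \<forall>n::nat. S t * indicator {..real n} t \<noteq> \<infinity>"
      unfolding AE_all_countable
      using S_fin by (intro allI nn_integral_PInf_AE) (auto simp: less_top)
    then show ?thesis
    proof eventually_elim
      case (elim t)
      obtain n where "t \<le> real n" using real_arch_simple by blast
      with elim[rule_format, of n] show ?case by (simp add: less_top)
    qed
  qed
  have summ: "summable (\<lambda>k. norm (H k t))" if "S t < \<infinity>" for t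
    using norm_S[of t] that by (intro summable_suminf_not_top) (auto simp: top_unique)
  \<comment> \<open>A total Borel function: where the series diverges \<open>suminf\<close> has an
    uncontrolled value, but divergence occurs only inside the null set on which S is
    infinite.\<close>
  define h where "h t = (\<Sum>k. H k t)" for t
  have h_meas[measurable]: "h \<in> borel_measurable borel" unfolding h_def by measurable
  have h_S: "ennreal ((norm (h t))\<^sup>2) \<le> 2 * S t" if "S t < \<infinity>" for t
  proof -
    have Q: "summable (\<lambda>k. 2 ^ k * (norm (H k t))\<^sup>2)"
      using that unfolding S_def by (intro summable_suminf_not_top) auto
    have "norm (h t) \<le> (\<Sum>k. norm (H k t))"
      unfolding h_def by (rule summable_norm[OF summ[OF that]])
    then have "(norm (h t))\<^sup>2 \<le> (\<Sum>k. norm (H k t))\<^sup>2"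
      by (rule power_mono) simp
    also have "\<dots> \<le> 2 * (\<Sum>k. 2 ^ k * (norm (H k t))\<^sup>2)"
      by (intro suminf_square_le summ that Q) simp
    finally have "ennreal ((norm (h t))\<^sup>2) \<le> ennreal (2 * (\<Sum>k. 2 ^ k * (norm (H k t))\<^sup>2))"
      by (rule ennreal_leI)
    also have "\<dots> = 2 * S t"
      unfolding S_def using Q by (subst suminf_ennreal2) (auto simp: ennreal_mult')
    finally show ?thesis .
  qed
  have "causal_L2 h"
  proof (rule causal_L2I_energy[of _ 0])
    show "h t = 0" if "t < 0" for t
      using that by (simp add: h_def causal_L2_neg[OF H])
    show "energy 0 T h < \<infinity>" for T
    proof -
      have "energy 0 T h \<le> (\<integral>\<^sup>+t. 2 * (S t * indicator {..T} t) \<partial>lborel)"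
        unfolding energy_def
      proof (rule nn_integral_mono_AE, use S_AE in eventually_elim)
        case (elim t)
        then show ?case using h_S[of t] by (simp split: split_indicator)
      qed
      also have "\<dots> = 2 * (\<integral>\<^sup>+t. S t * indicator {..T} t \<partial>lborel)"
        by (rule nn_integral_cmult) measurable
      also have "\<dots> < \<infinity>" using S_fin by (simp add: ennreal_mult_less_top)
      finally show ?thesis .
    qed
  qed simp_all
  moreover have "c t = primitive h t" for t
  proof -
    let ?f = "\<lambda>k s. indicat_real {0..t} s *\<^sub>R H k s"
    have int: "integrable lborel (?f k)" for k
      using causal_L2_integrable_subset[OF H, of "{0..t}" t] by (simp add: set_integrable_def)
    \<comment> \<open>An integrable majorant of the sum of the norms on \<open>{0..t}\<close>. It
      makes the integrals of the norms summable, as required for integrating the series term by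
      term.\<close>
    have "(\<Sum>k. ennreal (norm (?f k s))) \<le> 2 * indicator {0..t} s + S s * indicator {..t} s" for s
      using norm_S[of s] by (cases "s \<in> {0..t}") simp_all
    then have "(\<integral>\<^sup>+s. (\<Sum>k. ennreal (norm (?f k s))) \<partial>lborel)
        \<le> (\<integral>\<^sup>+s. 2 * indicator {0..t} s + S s * indicator {..t} s \<partial>lborel)"
      by (rule nn_integral_mono)
    also have "(\<integral>\<^sup>+s. 2 * indicator {0..t} s + S s * indicator {..t} s \<partial>lborel)
        = 2 * emeasure lborel {0..t} + (\<integral>\<^sup>+s. S s * indicator {..t} s \<partial>lborel)"
      by (subst nn_integral_add) (auto simp: nn_integral_cmult_indicator)
    finally have le: "(\<integral>\<^sup>+s. (\<Sum>k. ennreal (norm (?f k s))) \<partial>lborel)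
        \<le> 2 * emeasure lborel {0..t} + (\<integral>\<^sup>+s. S s * indicator {..t} s \<partial>lborel)" .
    have fin: "2 * emeasure lborel {0..t} + (\<integral>\<^sup>+s. S s * indicator {..t} s \<partial>lborel) < \<infinity>"
      using S_fin by (simp add: ennreal_mult_less_top emeasure_lborel_Icc_eq)
    have swap: "(\<integral>\<^sup>+s. (\<Sum>k. ennreal (norm (?f k s))) \<partial>lborel) = (\<Sum>k. \<integral>\<^sup>+s. ennreal (norm (?f k s)) \<partial>lborel)"
      by (rule nn_integral_suminf) measurable
    have norm_int: "(\<integral>\<^sup>+s. ennreal (norm (?f k s)) \<partial>lborel) = ennreal (LINT s|lborel. norm (?f k s))" for k
      by (rule nn_integral_eq_integral[OF integrable_norm[OF int]]) simp
    define L where "L k = (LINT s|lborel. norm (?f k s))" for k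
    have "(\<Sum>k. ennreal (L k)) < \<infinity>"
      using le_less_trans[OF le fin] unfolding swap norm_int L_def .
    moreover have "0 \<le> L k" for k
      unfolding L_def by (rule Bochner_Integration.integral_nonneg) (rule norm_ge_zero)
    ultimately have "summable L"
      by (intro summable_suminf_not_top) auto
    then have "summable (\<lambda>k. LINT s|lborel. norm (?f k s))"
      by (simp only: L_def[abs_def])
    moreover have "AE s in lborel. summable (\<lambda>k. norm (?f k s))"
      using S_AE
    proof eventually_elim
      case (elim s)
      show ?case using summable_mult[OF summ[OF elim], of "indicat_real {0..t} s"] by simp
    qed
    ultimately have "(\<lambda>k. LINT s|lborel. ?f k s) sums (LINT s|lborel. (\<Sum>k. ?f k s))"
      using int by (intro sums_integral)
    moreover have "(LINT s|lborel. ?f k s) = primitive (H k) t" for k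
      by (simp add: primitive_def set_lebesgue_integral_def)
    moreover have "(LINT s|lborel. (\<Sum>k. ?f k s)) = primitive h t"
      unfolding primitive_def set_lebesgue_integral_def h_def
      by (intro Bochner_Integration.integral_cong) (auto split: split_indicator)
    ultimately show ?thesis using sums_unique2[OF c_sums[of t]] by simp
  qed
  ultimately show ?thesis by blast
qed

section \<open>Sobolev signals and Borel versions\<close>

text \<open>The real-valued case is applied to each coordinate; \<open>Basis\<close> is finite, so
  the exceptional null sets may be united.\<close>

lemma lebesgue_ex_borel_measurable:
  fixes f :: "'b::euclidean_space \<Rightarrow> 'a::euclidean_space"
  assumes "f \<in> borel_measurable lebesgue"
  shows "\<exists>g\<in>borel_measurable borel. AE x in lborel. f x = g x"
proof -
  have "\<exists>g\<in>borel_measurable lborel. AE x in lborel. f x \<bullet> b = g x" for b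
    using assms by (intro completion_ex_borel_measurable_real) simp
  then obtain g where g: "\<And>b. g b \<in> borel_measurable lborel" "\<And>b. AE x in lborel. f x \<bullet> b = g b x"
    by metis
  then have [measurable]: "g b \<in> borel_measurable borel" for b by simp
  have "AE x in lborel. \<forall>b\<in>Basis. f x \<bullet> b = g b x"
    using g(2) by (intro AE_finite_allI) auto
  then have "AE x in lborel. f x = (\<Sum>b\<in>Basis. g b x *\<^sub>R b)"
  proof eventually_elim
    case (elim x)
    have "f x = (\<Sum>b\<in>Basis. (f x \<bullet> b) *\<^sub>R b)" by (rule euclidean_representation[symmetric])
    also have "\<dots> = (\<Sum>b\<in>Basis. g b x *\<^sub>R b)" using elim by (intro sum.cong) auto
    finally show ?case .
  qed
  then show ?thesis
    by (intro bexI[of _ "\<lambda>x. \<Sum>b\<in>Basis. g b x *\<^sub>R b"]) measurable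
qed

text \<open>Bridge between the system definitions, which integrate against \<open>lebesgue\<close>,
  and the operators above, which integrate Borel functions against \<open>lborel\<close>.\<close>

lemma set_lebesgue_integral_borel_version:
  fixes f :: "real \<Rightarrow> 'a::euclidean_space"
  assumes "set_borel_measurable lebesgue A f" "A \<in> sets borel" and [measurable]: "g \<in> borel_measurable borel"
    and "AE s in lborel. indicator A s *\<^sub>R f s = indicator A s *\<^sub>R g s"
  shows "(LINT s:A|lebesgue. f s) = (LINT s:A|lborel. g s)"
proof -
  have [measurable]: "A \<in> sets borel" by fact
  have "(LINT s:A|lebesgue. f s) = (LINT s|lebesgue. indicator A s *\<^sub>R g s)"
    unfolding set_lebesgue_integral_def
    using assms(1) by (intro integral_cong_AE AE_completion assms(4))
      (auto simp: set_borel_measurable_def intro: measurable_completion)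
  also have "\<dots> = (LINT s:A|lborel. g s)"
    unfolding set_lebesgue_integral_def by (rule integral_completion) measurable
  finally show ?thesis .
qed

lemma square_integrable_on_borel:
  fixes f :: "real \<Rightarrow> 'a::euclidean_space"
  assumes [measurable]: "f \<in> borel_measurable borel" "A \<in> sets borel"
  shows "f square_integrable_on A \<longleftrightarrow> (\<integral>\<^sup>+s. indicator A s * ennreal ((norm (f s))\<^sup>2) \<partial>lborel) < \<infinity>"
proof -
  have "set_borel_measurable lebesgue A f"
    unfolding set_borel_measurable_def by (intro measurable_completion) measurable
  moreover have "set_integrable lebesgue A (\<lambda>t. (norm (f t))\<^sup>2) \<longleftrightarrow> integrable lborel (\<lambda>t. indicat_real A t *\<^sub>R (norm (f t))\<^sup>2)"
    unfolding set_integrable_def by (intro integrable_completion) measurable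
  moreover have "(\<integral>\<^sup>+s. ennreal (norm (indicat_real A s *\<^sub>R (norm (f s))\<^sup>2)) \<partial>lborel)
      = (\<integral>\<^sup>+s. indicator A s * ennreal ((norm (f s))\<^sup>2) \<partial>lborel)"
    by (intro nn_integral_cong) (auto split: split_indicator)
  ultimately show ?thesis
    unfolding square_integrable_on_def by (simp add: integrable_iff_bounded)
qed

lemma energy_unweighted:
  assumes "\<And>t. t < 0 \<Longrightarrow> h t = 0"
  shows "energy 0 T h = (\<integral>\<^sup>+s. indicator {0..T} s * ennreal ((norm (h s))\<^sup>2) \<partial>lborel)"
  unfolding energy_def
  by (intro nn_integral_cong) (use assms in \<open>auto split: split_indicator\<close>)

lemma causal_L2_iff_square_integrable:
  assumes "h \<in> borel_measurable borel" "\<And>t. t < 0 \<Longrightarrow> h t = 0"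
  shows "causal_L2 h \<longleftrightarrow> (\<forall>T\<ge>0. h square_integrable_on {0..T})"
proof -
  have e: "energy 0 T h = (\<integral>\<^sup>+s. indicator {0..T} s * ennreal ((norm (h s))\<^sup>2) \<partial>lborel)" for T
    by (rule energy_unweighted) (rule assms(2))
  have *: "energy 0 T h < \<infinity> \<longleftrightarrow> h square_integrable_on {0..T}" for T
    unfolding square_integrable_on_borel[OF assms(1), of "{0..T}", simplified] e by simp
  have "energy 0 T h < \<infinity>" if "T < 0" for T
  proof -
    have "energy 0 T h = 0"
      unfolding e using that by simp
    then show ?thesis by simp
  qed
  then have "(\<forall>T. energy 0 T h < \<infinity>) \<longleftrightarrow> (\<forall>T\<ge>0. h square_integrable_on {0..T})"
    unfolding *[symmetric] by (meson linorder_not_le)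
  then show ?thesis
    using assms by (simp add: causal_L2_def)
qed

lemma W12_imp_primitive:
  fixes w :: "real \<Rightarrow> 'a::euclidean_space"
  assumes "W12 {0..} w" "\<forall>t\<le>0. w t = 0"
  shows "\<exists>h. causal_L2 h \<and> w = primitive h"
proof -
  obtain g where g: "g square_integrable_on {0..}"
    and w: "\<forall>a\<in>{0..}. \<forall>b\<in>{0..}. a \<le> b \<longrightarrow> w b - w a = (LINT t:{a..b}|lebesgue. g t)"
    using assms(1) unfolding W12_def by blast
  have "(\<lambda>t. indicat_real {0..} t *\<^sub>R g t) \<in> borel_measurable lebesgue"
    using g by (simp add: square_integrable_on_def set_borel_measurable_def)
  then obtain h where [measurable]: "h \<in> borel_measurable borel"
    and h: "AE t in lborel. indicat_real {0..} t *\<^sub>R g t = h t"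
    using lebesgue_ex_borel_measurable by blast
  \<comment> \<open>The Borel version agrees with the cut-off function only almost everywhere and
    may be nonzero at some negative times; the cut makes it vanish at all of them, as
    \<open>causal_L2\<close> demands.\<close>
  define h0 where "h0 t = (if t < 0 then 0 else h t)" for t
  have [measurable]: "h0 \<in> borel_measurable borel" unfolding h0_def by measurable
  have h0: "AE t in lborel. indicat_real {0..} t *\<^sub>R g t = h0 t"
    using h by eventually_elim (auto simp: h0_def)
  have fin: "(\<integral>\<^sup>+s. ennreal (norm (indicat_real {0..} s *\<^sub>R (norm (g s))\<^sup>2)) \<partial>lborel) < \<infinity>"
    using g by (simp add: square_integrable_on_def set_integrable_def integrable_iff_bounded nn_integral_completion)
  have "causal_L2 h0"
  proof (rule causal_L2I_energy[of _ 0])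
    fix T
    have "energy 0 T h0 \<le> (\<integral>\<^sup>+s. ennreal (norm (indicat_real {0..} s *\<^sub>R (norm (g s))\<^sup>2)) \<partial>lborel)"
      unfolding energy_def
    proof (rule nn_integral_mono_AE, use h0 in eventually_elim)
      case (elim t)
      then show ?case
        by (cases "t < 0") (auto simp: h0_def split: split_indicator)
    qed
    with fin show "energy 0 T h0 < \<infinity>" by simp
  qed (simp_all add: h0_def)
  moreover have "w t = primitive h0 t" for t
  proof (cases "t \<le> 0")
    case True
    with assms(2) show ?thesis by (simp add: primitive_neg)
  next
    case False
    have "w t = (LINT s:{0..t}|lebesgue. g s)"
      using w[rule_format, of 0 t] False assms(2) by simp
    also have "\<dots> = (LINT s:{0..t}|lborel. h0 s)"
    proof (rule set_lebesgue_integral_borel_version)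
      have "(\<lambda>s. indicat_real {0..t} s *\<^sub>R (indicat_real {0..} s *\<^sub>R g s)) \<in> borel_measurable lebesgue"
      proof (rule borel_measurable_scaleR)
        show "indicat_real {0..t} \<in> borel_measurable lebesgue"
          by (intro borel_measurable_indicator) simp
        show "(\<lambda>s. indicat_real {0..} s *\<^sub>R g s) \<in> borel_measurable lebesgue" by fact
      qed
      moreover have "(\<lambda>s. indicat_real {0..t} s *\<^sub>R (indicat_real {0..} s *\<^sub>R g s)) = (\<lambda>s. indicat_real {0..t} s *\<^sub>R g s)"
        by (auto split: split_indicator)
      ultimately show "set_borel_measurable lebesgue {0..t} g"
        by (simp add: set_borel_measurable_def)
      show "AE s in lborel. indicat_real {0..t} s *\<^sub>R g s = indicat_real {0..t} s *\<^sub>R h0 s"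
        using h0 by eventually_elim (auto split: split_indicator_asm split_indicator)
    qed simp_all
    finally show ?thesis by (simp add: primitive_def)
  qed
  ultimately show ?thesis by blast
qed

lemma causal_L2_square_integrable_window:
  assumes "causal_L2 h"
  shows "(\<lambda>s. h (t + s)) square_integrable_on {-\<tau>..0}"
proof -
  have [measurable]: "h \<in> borel_measurable borel" using assms by (rule causal_L2_measurable)
  have "(\<integral>\<^sup>+s. indicator {-\<tau>..0} s * ennreal ((norm (h (t + s)))\<^sup>2) \<partial>lborel)
     \<le> (\<integral>\<^sup>+s. indicator {..t} (t + 1 * s) * ennreal ((norm (h (t + 1 * s)))\<^sup>2) \<partial>lborel)"
    by (intro nn_integral_mono) (auto split: split_indicator)
  also have "\<dots> = (\<integral>\<^sup>+s. indicator {..t} s * ennreal ((norm (h s))\<^sup>2) \<partial>lborel)"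
    by (subst (2) nn_integral_real_affine[where c=1 and t=t]) simp_all
  also have "\<dots> = energy 0 t h"
    unfolding energy_def by (intro nn_integral_cong) (simp add: mult.commute)
  also have "\<dots> < \<infinity>" using assms by (simp add: causal_L2_def)
  finally show ?thesis by (subst square_integrable_on_borel) simp_all
qed

lemma primitive_diff:
  assumes h: "causal_L2 h" and "a \<le> b"
  shows "primitive h b - primitive h a = (LINT s:{a..b}|lborel. h s)"
proof -
  have [measurable]: "h \<in> borel_measurable borel" using h by (rule causal_L2_measurable)
  have int: "integrable lborel (\<lambda>s. indicat_real {0..r} s *\<^sub>R h s)" for r
    using causal_L2_integrable_subset[OF h, of "{0..r}" r] by (simp add: set_integrable_def)
  have "primitive h b - primitive h a = (LINT s|lborel. indicat_real {0..b} s *\<^sub>R h s - indicat_real {0..a} s *\<^sub>R h s)"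
    unfolding primitive_def set_lebesgue_integral_def
    by (rule Bochner_Integration.integral_diff[symmetric]) (rule int)+
  also have "\<dots> = (LINT s|lborel. indicat_real {a..b} s *\<^sub>R h s)"
  proof (rule integral_cong_AE)
    \<comment> \<open>For a \<ge> 0 the two sides can differ only at s = a, an endpoint of both
      closed intervals; when a < 0, causality removes the negative part of
      \<open>{a..b}\<close>.\<close>
    show "AE s in lborel. indicat_real {0..b} s *\<^sub>R h s - indicat_real {0..a} s *\<^sub>R h s = indicat_real {a..b} s *\<^sub>R h s"
      using AE_lborel_singleton[of a]
    proof eventually_elim
      case (elim s)
      then show ?case
        using causal_L2_neg[OF h, of s] \<open>a \<le> b\<close> by (cases "s < 0") (auto split: split_indicator)
    qed
  qed measurable
  finally show ?thesis by (simp add: set_lebesgue_integral_def)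
qed

lemma W12_primitive_window:
  assumes h: "causal_L2 h"
  shows "W12 {-\<tau>..0} (\<lambda>s. primitive h (t + s))"
  unfolding W12_def
proof (intro conjI exI[of _ "\<lambda>s. h (t + s)"] ballI impI)
  have [measurable]: "h \<in> borel_measurable borel" using h by (rule causal_L2_measurable)
  show "(\<lambda>s. primitive h (t + s)) square_integrable_on {-\<tau>..0}"
    "(\<lambda>s. h (t + s)) square_integrable_on {-\<tau>..0}"
    by (intro causal_L2_square_integrable_window causal_L2_primitive h)+
  fix a b :: real assume "a \<le> b"
  then have "primitive h (t + b) - primitive h (t + a) = (LINT s|lborel. indicat_real {t + a..t + b} s *\<^sub>R h s)"
    by (subst primitive_diff[OF h]) (auto simp: set_lebesgue_integral_def)
  also have "\<dots> = (LINT s|lborel. indicat_real {t + a..t + b} (t + s) *\<^sub>R h (t + s))"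
    by (subst lborel_integral_real_affine[where c=1 and t=t]) simp_all
  also have "\<dots> = (LINT s|lborel. indicat_real {a..b} s *\<^sub>R h (t + s))"
    by (intro Bochner_Integration.integral_cong) (auto split: split_indicator)
  also have "\<dots> = (LINT s:{a..b}|lebesgue. h (t + s))"
    unfolding set_lebesgue_integral_def by (rule integral_completion[symmetric]) measurable
  finally show "primitive h (t + b) - primitive h (t + a) = (LINT s:{a..b}|lebesgue. h (t + s))" .
qed

section \<open>The one-sided derivative of the state\<close>

lemma tderiv_has_vector_derivative:
  assumes "x differentiable_on {0..}" "0 \<le> t"
  shows "(x has_vector_derivative tderiv x t) (at t within {0..})"
proof -
  have "x differentiable at t within {0..}"
    using assms by (auto simp: differentiable_on_def)
  then show ?thesis
    using assms(2) by (simp add: tderiv_def vector_derivative_works)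
qed

lemma causal_borel_measurable:
  fixes x :: "real \<Rightarrow> 'a::euclidean_space"
  assumes "x differentiable_on {0..}" "\<forall>t\<le>0. x t = 0"
  shows "x \<in> borel_measurable borel"
proof -
  have "continuous_on ({..0} \<union> {0..}) x"
  proof (rule continuous_on_closed_Un)
    show "continuous_on {..0} x"
      using assms(2) by (subst continuous_on_cong[OF refl, of _ _ "\<lambda>_. 0"]) auto
    show "continuous_on {0..} x"
      by (rule differentiable_imp_continuous_on) fact
  qed auto
  moreover have "{..0} \<union> {0..} = (UNIV :: real set)" by auto
  ultimately show ?thesis by (auto intro: borel_measurable_continuous_onI)
qed

text \<open>A pointwise limit of forward difference quotients with step 1 / (n + 1). Forward steps
  stay in \<open>{0..}\<close>, so the argument also covers t = 0; the quotients are set to 0 at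
  negative times to match \<open>tderiv\<close>.\<close>

lemma tderiv_borel_measurable:
  fixes x :: "real \<Rightarrow> 'a::euclidean_space"
  assumes "x differentiable_on {0..}" "\<forall>t\<le>0. x t = 0"
  shows "tderiv x \<in> borel_measurable borel"
proof (rule borel_measurable_LIMSEQ_metric)
  have [measurable]: "x \<in> borel_measurable borel" using assms by (rule causal_borel_measurable)
  define q where "q n t = (if t < 0 then 0 else real (Suc n) *\<^sub>R (x (t + 1 / real (Suc n)) - x t))" for n t
  show "q n \<in> borel_measurable borel" for n unfolding q_def by measurable
  show "(\<lambda>n. q n t) \<longlonglongrightarrow> tderiv x t" for t
  proof (cases "t < 0")
    case True
    then show ?thesis by (simp add: q_def tderiv_def)
  next
    case False
    then have "(x has_derivative (\<lambda>r. r *\<^sub>R tderiv x t)) (at t within {0..})"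
      using tderiv_has_vector_derivative[OF assms(1), of t] by (simp add: has_vector_derivative_def)
    then have "((\<lambda>y. (1 / norm (y - t)) *\<^sub>R (x y - (x t + (y - t) *\<^sub>R tderiv x t))) \<longlongrightarrow> 0) (at t within {0..})"
      by (simp add: has_derivative_within)
    moreover have "filterlim (\<lambda>n. t + 1 / real (Suc n)) (at t within {0..}) sequentially"
      unfolding filterlim_at
    proof
      show "\<forall>\<^sub>F n in sequentially. t + 1 / real (Suc n) \<in> {0..} \<and> t + 1 / real (Suc n) \<noteq> t"
        using False by (intro always_eventually) auto
      have "(\<lambda>n. t + 1 / real (Suc n)) \<longlonglongrightarrow> t + 0"
        by (intro tendsto_add tendsto_const LIMSEQ_Suc[OF lim_1_over_n])
      then show "(\<lambda>n. t + 1 / real (Suc n)) \<longlonglongrightarrow> t" by simp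
    qed
    ultimately have "(\<lambda>n. (1 / norm (t + 1 / real (Suc n) - t)) *\<^sub>R (x (t + 1 / real (Suc n)) - (x t + (t + 1 / real (Suc n) - t) *\<^sub>R tderiv x t))) \<longlonglongrightarrow> 0"
      by (rule filterlim_compose)
    moreover have "(1 / norm (t + 1 / real (Suc n) - t)) *\<^sub>R (x (t + 1 / real (Suc n)) - (x t + (t + 1 / real (Suc n) - t) *\<^sub>R tderiv x t)) = q n t - tderiv x t" for n
      using False by (simp add: q_def scaleR_diff_right scaleR_add_right)
    ultimately have "(\<lambda>n. q n t - tderiv x t) \<longlonglongrightarrow> 0" by simp
    then show ?thesis by (simp add: LIM_zero_iff)
  qed
qed

text \<open>Differentiability at every point gives the fundamental theorem for the Henstock-Kurzweil
  integral; local square integrability makes that integral a Lebesgue integral. Hence no absolute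
  continuity of \<open>x\<close> has to be assumed.\<close>

lemma primitive_tderiv:
  fixes x :: "real \<Rightarrow> 'a::euclidean_space"
  assumes "x differentiable_on {0..}" "\<forall>t\<le>0. x t = 0" "causal_L2 (tderiv x)"
  shows "x = primitive (tderiv x)"
proof
  fix t
  show "x t = primitive (tderiv x) t"
  proof (cases "t \<le> 0")
    case True
    then show ?thesis using assms(2) by (simp add: primitive_neg)
  next
    case False
    have "(tderiv x has_integral x t - x 0) {0..t}"
    proof (rule fundamental_theorem_of_calculus)
      fix s assume "s \<in> {0..t}"
      then show "(x has_vector_derivative tderiv x s) (at s within {0..t})"
        using tderiv_has_vector_derivative[OF assms(1), of s]
        by (auto intro: has_vector_derivative_within_subset)
    qed (use False in simp)
    moreover have "(LINT s:{0..t}|lborel. tderiv x s) = integral {0..t} (tderiv x)"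
      using causal_L2_integrable_subset[OF assms(3), of "{0..t}" t]
      by (intro set_borel_integral_eq_integral) auto
    ultimately show ?thesis
      using assms(2) by (simp add: primitive_def integral_unique)
  qed
qed

section \<open>Bounded measurable kernels\<close>

lemma bounded_measurable_on_add:
  assumes "bounded_measurable_on f S" "bounded_measurable_on g S"
  shows "bounded_measurable_on (\<lambda>s. f s + g s) S"
  using assms unfolding bounded_measurable_on_def set_borel_measurable_def
  by (auto simp: scaleR_add_right intro: bounded_plus_comp)

lemma bounded_measurable_on_linear:
  assumes "bounded_measurable_on f S" "bounded_linear A"
  shows "bounded_measurable_on (\<lambda>s. A (f s)) S"
proof -
  have "A \<in> borel_measurable borel"
    by (intro borel_measurable_continuous_onI linear_continuous_on assms)
  then have "(\<lambda>s. A (indicat_real S s *\<^sub>R f s)) \<in> borel_measurable lebesgue"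
    using assms(1) unfolding bounded_measurable_on_def set_borel_measurable_def
    by (auto intro: measurable_compose)
  moreover have "bounded (A ` f ` S)"
    by (rule bounded_linear_image) (use assms in \<open>simp_all add: bounded_measurable_on_def\<close>)
  moreover have "A (indicat_real S s *\<^sub>R f s) = indicat_real S s *\<^sub>R A (f s)" for s
    by (rule linear_simps(5)[OF assms(2)])
  moreover have "A ` f ` S = (\<lambda>s. A (f s)) ` S"
    by (simp only: image_image)
  ultimately show ?thesis
    unfolding bounded_measurable_on_def set_borel_measurable_def by simp
qed

lemma bounded_measurable_on_borel_version:
  fixes f :: "real \<Rightarrow> 'a::euclidean_space"
  assumes "bounded_measurable_on f S" and [measurable]: "S \<in> sets borel"
  obtains k C where "k \<in> borel_measurable borel" "\<And>s. norm (k s) \<le> C" "\<And>s. s \<notin> S \<Longrightarrow> k s = 0"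
    "AE s in lborel. indicator S s *\<^sub>R f s = k s"
proof -
  obtain g where [measurable]: "g \<in> borel_measurable borel"
    and g: "AE s in lborel. indicat_real S s *\<^sub>R f s = g s"
    using lebesgue_ex_borel_measurable[of "\<lambda>s. indicat_real S s *\<^sub>R f s"] assms(1)
    by (auto simp: bounded_measurable_on_def set_borel_measurable_def)
  obtain C where C: "0 < C" "\<And>s. s \<in> S \<Longrightarrow> norm (f s) \<le> C"
    using assms(1) unfolding bounded_measurable_on_def bounded_pos by auto
  \<comment> \<open>The Borel version respects the bound and the support only almost everywhere;
    truncation restores both at every point and changes nothing outside the null set.\<close>
  define k where "k s = (if s \<in> S \<and> norm (g s) \<le> C then g s else 0)" for s
  show ?thesis
  proof (rule that[of k C])
    show "k \<in> borel_measurable borel" unfolding k_def by measurable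
    show "AE s in lborel. indicat_real S s *\<^sub>R f s = k s"
      using g
    proof eventually_elim
      case (elim s)
      then show ?case using C(2)[of s] by (auto simp: k_def split: split_indicator_asm)
    qed
  qed (use C(1) in \<open>auto simp: k_def\<close>)
qed

section \<open>Block vectors and the equivalence\<close>

lemma stack_nth [simp]: "(a \<sslash> b) $ Inl i = a $ i" "(a \<sslash> b) $ Inr j = b $ j"
  by (simp_all add: stack_def)

lemma stack_eq_iff: "a \<sslash> b = c \<sslash> d \<longleftrightarrow> a = c \<and> b = d"
  by (metis (no_types) stack_nth vec_eq_iff)

lemma stack_exhaust: obtains a b where "v = a \<sslash> b"
proof
  show "v = (\<chi> i. v $ Inl i) \<sslash> (\<chi> j. v $ Inr j)"
    by (simp add: vec_eq_iff stack_def split: sum.splits)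
qed

lemma stack_add: "(a \<sslash> b) + (c \<sslash> d) = (a + c) \<sslash> (b + d)"
  by (simp add: vec_eq_iff stack_def split: sum.splits)

lemma stack_scaleR: "r *\<^sub>R (a \<sslash> b) = (r *\<^sub>R a) \<sslash> (r *\<^sub>R b)"
  by (simp add: vec_eq_iff stack_def split: sum.splits)

lemma stack_zero: "0 \<sslash> 0 = 0"
  by (simp add: vec_eq_iff stack_def split: sum.splits)

lemma beside_add: "A \<bbar> B + C \<bbar> D = (A + C) \<bbar> (B + D)"
  by (simp add: beside_def vec_eq_iff stack_def split: sum.splits)

lemma beside_scaleR: "r *\<^sub>R (A \<bbar> B) = (r *\<^sub>R A) \<bbar> (r *\<^sub>R B)"
  by (simp add: beside_def vec_eq_iff stack_def split: sum.splits)

lemma stack_mult_vec: "(A \<sslash> B) *v x = (A *v x) \<sslash> (B *v x)"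
  by (simp add: vec_eq_iff matrix_vector_mult_def stack_def split: sum.splits)

lemma beside_mult_vec:
  fixes A :: "real^'i::finite^'k" and B :: "real^'j::finite^'k"
  shows "(A \<bbar> B) *v (x \<sslash> y) = A *v x + B *v y"
proof (rule vec_eq_iff[THEN iffD2], rule allI)
  fix k
  have "((A \<bbar> B) *v (x \<sslash> y)) $ k = (\<Sum>j\<in>UNIV <+> UNIV. (A $ k \<sslash> B $ k) $ j * (x \<sslash> y) $ j)"
    by (simp add: matrix_vector_mult_def beside_def)
  also have "\<dots> = (A *v x + B *v y) $ k"
    by (subst sum.Plus) (simp_all add: matrix_vector_mult_def)
  finally show "((A \<bbar> B) *v (x \<sslash> y)) $ k = (A *v x + B *v y) $ k" .
qed

lemmas block_simps = stack_mult_vec beside_mult_vec stack_add stack_eq_iff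

lemma bounded_linear_stack:
  shows bounded_linear_stack_left: "bounded_linear (\<lambda>a. (a :: 'a::euclidean_space^'i::finite) \<sslash> (0 :: 'a^'j::finite))"
    and bounded_linear_stack_right: "bounded_linear (\<lambda>b. (0 :: 'a::euclidean_space^'i::finite) \<sslash> (b :: 'a^'j::finite))"
  by (auto simp: linear_conv_bounded_linear[symmetric] stack_add stack_scaleR intro!: linearI)

lemma bounded_linear_beside:
  shows bounded_linear_beside_left: "bounded_linear (\<lambda>A. (A :: real^'i::finite^'k::finite) \<bbar> (0 :: real^'j::finite^'k))"
    and bounded_linear_beside_right: "bounded_linear (\<lambda>B. (0 :: real^'i::finite^'k::finite) \<bbar> (B :: real^'j::finite^'k))"
  by (auto simp: linear_conv_bounded_linear[symmetric] beside_add beside_scaleR intro!: linearI)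

text \<open>Writes a block as a sum of two linear embeddings, so that closure under sums and bounded
  linear maps carries over to blocks.\<close>

lemma stack_decompose: "a \<sslash> b = (a \<sslash> 0) + (0 \<sslash> b)" for a :: "'a::monoid_add^'i" and b :: "'a^'j"
  by (simp add: stack_add)

lemma beside_decompose: "A \<bbar> B = A \<bbar> 0 + 0 \<bbar> (B :: real^'j^'k)" for A :: "real^'i^'k"
  by (simp add: beside_add)

lemma bounded_measurable_on_stack:
  fixes f :: "real \<Rightarrow> 'a::euclidean_space^'i::finite" and g :: "real \<Rightarrow> 'a^'j::finite"
  assumes "bounded_measurable_on f S" "bounded_measurable_on g S"
  shows "bounded_measurable_on (\<lambda>s. f s \<sslash> g s) S"
  by (subst stack_decompose, intro bounded_measurable_on_add
      bounded_measurable_on_linear[OF assms(1) bounded_linear_stack_left]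
      bounded_measurable_on_linear[OF assms(2) bounded_linear_stack_right])

lemma bounded_measurable_on_beside:
  fixes f :: "real \<Rightarrow> real^'i::finite^'k::finite" and g :: "real \<Rightarrow> real^'j::finite^'k"
  assumes "bounded_measurable_on f S" "bounded_measurable_on g S"
  shows "bounded_measurable_on (\<lambda>s. f s \<bbar> g s) S"
  by (subst beside_decompose, intro bounded_measurable_on_add
      bounded_measurable_on_linear[OF assms(1) bounded_linear_beside_left]
      bounded_measurable_on_linear[OF assms(2) bounded_linear_beside_right])

lemma nds_distributed_bounded_measurable:
  assumes "nds_bounded_measurable K \<tau> N" "i \<in> {1..K}"
  shows "bounded_measurable_on (nds_distributed N i) {-\<tau> i..0}"
proof -
  have "bounded_measurable_on (\<lambda>s. nds_distributed N i s) {-\<tau> i..0}"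
    unfolding nds_distributed_def
    using assms unfolding nds_bounded_measurable_def
    by (intro bounded_measurable_on_stack bounded_measurable_on_beside) simp_all
  then show ?thesis by simp
qed

lemma causal_L2_stack:
  fixes f :: "real \<Rightarrow> real^'i::finite" and g :: "real \<Rightarrow> real^'j::finite"
  assumes "causal_L2 f" "causal_L2 g"
  shows "causal_L2 (\<lambda>t. f t \<sslash> g t)"
  by (subst stack_decompose, intro causal_L2_add
      causal_L2_linear[OF assms(1) bounded_linear_stack_left]
      causal_L2_linear[OF assms(2) bounded_linear_stack_right])

lemma primitive_stack:
  fixes f :: "real \<Rightarrow> real^'i::finite" and g :: "real \<Rightarrow> real^'j::finite"
  assumes "causal_L2 f" "causal_L2 g"
  shows "primitive (\<lambda>t. f t \<sslash> g t) t = primitive f t \<sslash> primitive g t"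
proof -
  have "primitive (\<lambda>t. f t \<sslash> g t) t = primitive (\<lambda>t. (f t \<sslash> 0) + (0 \<sslash> g t)) t"
    by (subst stack_decompose) simp
  also have "\<dots> = primitive (\<lambda>t. f t \<sslash> 0) t + primitive (\<lambda>t. 0 \<sslash> g t) t"
    by (intro primitive_add causal_L2_linear[OF assms(1) bounded_linear_stack_left]
      causal_L2_linear[OF assms(2) bounded_linear_stack_right])
  also have "\<dots> = (primitive f t \<sslash> 0) + (0 \<sslash> primitive g t)"
    by (simp only: primitive_linear[OF assms(1) bounded_linear_stack_left]
      primitive_linear[OF assms(2) bounded_linear_stack_right])
  finally show ?thesis by (simp add: stack_add)
qed

text \<open>The projection used to peel the leading blocks off a signal column.\<close>

lemma bounded_linear_lower: "bounded_linear (\<lambda>v :: real^('i::finite + 'j::finite). \<chi> j. v $ Inr j)"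
  by (auto simp: linear_conv_bounded_linear[symmetric] vec_eq_iff intro!: linearI)

lemma bounded_bilinear_mult_vec:
  "bounded_bilinear ((*v) :: real^'i::finite^'k::finite \<Rightarrow> real^'i \<Rightarrow> real^'k)"
  by (auto simp: bilinear_conv_bounded_bilinear[symmetric] bilinear_def matrix_vector_mult_add_rdistrib
      matrix_vector_mult_scaleR scaleR_matrix_vector_assoc matrix_vector_right_distrib intro!: linearI)

text \<open>The operator is the convolution with a Borel version of the kernel. Changing the kernel
  on a null set alters no integral, so the agreement holds at every t.\<close>

lemma distributed_delay_memory_op:
  fixes M :: "real \<Rightarrow> real^'c::finite^'v::finite"
  assumes M: "bounded_measurable_on M {-\<tau>..0}" and "0 < \<tau>"
  shows "\<exists>\<Psi>. memory_op \<Psi> \<and>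
    (\<forall>c t. causal_L2 c \<longrightarrow> (LINT s:{-\<tau>..0}|lebesgue. M s *v c (t + s)) = \<Psi> c t)"
proof -
  obtain k C where k: "k \<in> borel_measurable borel" "\<And>s. norm (k s) \<le> C" "\<And>s. s \<notin> {-\<tau>..0} \<Longrightarrow> k s = 0"
    "AE s in lborel. indicator {-\<tau>..0} s *\<^sub>R M s = k s"
    using bounded_measurable_on_borel_version[OF M] by auto
  interpret bounded_kernel "(*v) :: real^'c^'v \<Rightarrow> real^'c \<Rightarrow> real^'v" k C \<tau>
    using bounded_bilinear_mult_vec k \<open>0 < \<tau>\<close>
    by (auto simp: bounded_kernel_def bounded_kernel_axioms_def)
  show ?thesis
  proof (intro exI[of _ conv] conjI allI impI memory_op_conv)
    fix c :: "real \<Rightarrow> real^'c" and t assume "causal_L2 c"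
    then have [measurable]: "c \<in> borel_measurable borel" by (rule causal_L2_measurable)
    have supp: "indicat_real {-\<tau>..0} s *\<^sub>R (k s *v c (t + s)) = k s *v c (t + s)" for s
      using k(3)[of s] by (cases "s \<in> {-\<tau>..0}") auto
    have "(LINT s:{-\<tau>..0}|lebesgue. M s *v c (t + s)) = (LINT s:{-\<tau>..0}|lborel. k s *v c (t + s))"
    proof (rule set_lebesgue_integral_borel_version)
      have "(\<lambda>s. (indicat_real {-\<tau>..0} s *\<^sub>R M s) *v c (t + s)) \<in> borel_measurable lebesgue"
      proof (rule prod_measurable)
        show "(\<lambda>s. indicat_real {-\<tau>..0} s *\<^sub>R M s) \<in> borel_measurable lebesgue"
          using M by (simp add: bounded_measurable_on_def set_borel_measurable_def)
        show "(\<lambda>s. c (t + s)) \<in> borel_measurable lebesgue"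
          by (intro measurable_completion) measurable
      qed
      then show "set_borel_measurable lebesgue {-\<tau>..0} (\<lambda>s. M s *v c (t + s))"
        by (simp add: set_borel_measurable_def scaleR_left)
      show "AE s in lborel. indicat_real {-\<tau>..0} s *\<^sub>R (M s *v c (t + s)) = indicat_real {-\<tau>..0} s *\<^sub>R (k s *v c (t + s))"
        using k(4)
      proof eventually_elim
        case (elim s)
        then show ?case by (cases "s \<in> {-\<tau>..0}") auto
      qed
    qed (simp, measurable)
    also have "\<dots> = conv c t"
      unfolding conv_def set_lebesgue_integral_def supp ..
    finally show "(LINT s:{-\<tau>..0}|lebesgue. M s *v c (t + s)) = conv c t" .
  qed
qed

text \<open>\<open>\<Psi>\<close> is fixed before the signals, so one operator represents the memory
  term for all of them. Each delayed term is a pure delay followed by a matrix.\<close>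

lemma nds_memory_op:
  assumes "delays K \<tau>" "nds_bounded_measurable K \<tau> N"
  obtains \<Psi> where "memory_op \<Psi>"
    "\<And>x w u t. causal_L2 (nds_column x w u) \<Longrightarrow> nds_memory K \<tau> N w u x t = \<Psi> (nds_column x w u) t"
proof -
  have pos: "0 < \<tau> i" if "i \<in> {1..K}" for i
    using assms(1) that by (auto simp: delays_def)
  define represents where "represents i \<Psi> \<longleftrightarrow> memory_op \<Psi> \<and> (\<forall>c t. causal_L2 c \<longrightarrow>
      (LINT s:{-\<tau> i..0}|lebesgue. nds_distributed N i s *v c (t + s)) = \<Psi> c t)" for i \<Psi>
  have "\<forall>i\<in>{1..K}. \<exists>\<Psi>. represents i \<Psi>"
    unfolding represents_def
    by (intro ballI distributed_delay_memory_op nds_distributed_bounded_measurable[OF assms(2)] pos)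
  then obtain \<Psi> where "\<forall>i\<in>{1..K}. represents i (\<Psi> i)"
    by (rule bchoice[THEN exE])
  then have \<Psi>: "\<And>i. i \<in> {1..K} \<Longrightarrow> memory_op (\<Psi> i)"
    "\<And>i c t. i \<in> {1..K} \<Longrightarrow> causal_L2 c \<Longrightarrow>
      (LINT s:{-\<tau> i..0}|lebesgue. nds_distributed N i s *v c (t + s)) = \<Psi> i c t"
    by (simp_all add: represents_def)
  show ?thesis
  proof (rule that)
    show "memory_op (\<lambda>c t. (\<Sum>i=1..K. nds_delayed N i *v c (t - \<tau> i)) + (\<Sum>i=1..K. \<Psi> i c t))"
      by (intro memory_op_add memory_op_sum memory_op_linear[OF memory_op_delay]
          matrix_vector_mul_bounded_linear) (auto simp: pos \<Psi>)
  qed (simp add: nds_memory_def \<Psi>)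
qed

text \<open>The fourth row of the DDF is implied by the first three.\<close>

lemma ddf_rows_iff_nds_rows:
  "tderiv x t \<sslash> z t \<sslash> y t \<sslash> nds_column x w u t =
      ((ddf.A0 (ddf_of_nds N) \<bbar> ddf.B1 (ddf_of_nds N) \<bbar> ddf.B2 (ddf_of_nds N)) \<sslash>
       (ddf.C1 (ddf_of_nds N) \<bbar> ddf.D11 (ddf_of_nds N) \<bbar> ddf.D12 (ddf_of_nds N)) \<sslash>
       (ddf.C2 (ddf_of_nds N) \<bbar> ddf.D21 (ddf_of_nds N) \<bbar> ddf.D22 (ddf_of_nds N)) \<sslash>
       (Cri (ddf_of_nds N) i \<bbar> Br1i (ddf_of_nds N) i \<bbar> Br2i (ddf_of_nds N) i)) *v (x t \<sslash> w t \<sslash> u t) +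
      (Bv (ddf_of_nds N) \<sslash> D1v (ddf_of_nds N) \<sslash> D2v (ddf_of_nds N) \<sslash> Drvi (ddf_of_nds N) i) *v v
   \<longleftrightarrow> tderiv x t \<sslash> z t \<sslash> y t = nds_direct N *v (x t \<sslash> w t \<sslash> u t) + v"
proof -
  obtain v1 v23 where "v = v1 \<sslash> v23" by (rule stack_exhaust)
  moreover obtain v2 v3 where "v23 = v2 \<sslash> v3" by (rule stack_exhaust)
  ultimately have v: "v = v1 \<sslash> v2 \<sslash> v3" by simp
  show ?thesis
    unfolding v nds_direct_def nds_column_def
    by (auto simp: ddf_of_nds_def block_simps stack_zero)
qed

lemma W12_zero_window: "W12 {-\<tau>..0} (\<lambda>s. 0)"
  using W12_primitive_window[OF causal_L2_zero] by (simp add: primitive_def)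

text \<open>The windows ending at \<tau>, 2 \<tau>, 3 \<tau>, ... cover the positive half-line, and
  each adds finite energy. The induction starts with the single time 0, a null set.\<close>

lemma causal_L2_from_windows:
  fixes f :: "real \<Rightarrow> 'a::euclidean_space"
  assumes [measurable]: "f \<in> borel_measurable borel" and neg: "\<And>t. t < 0 \<Longrightarrow> f t = 0"
    and "0 < \<tau>" and win: "\<And>t. 0 \<le> t \<Longrightarrow> (\<lambda>s. f (t + s)) square_integrable_on {-\<tau>..0}"
  shows "causal_L2 f"
proof (rule causal_L2I_energy[of _ 0])
  fix T
  have step: "energy 0 (real j * \<tau>) f < \<infinity>" for j
  proof (induction j)
    case 0
    have "(\<integral>\<^sup>+t. ennreal (exp (- (0 * t)) * (norm (f t))\<^sup>2) * indicator {..0} t \<partial>lborel) = (\<integral>\<^sup>+t. (0::ennreal) \<partial>(lborel::real measure))"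
    proof (rule nn_integral_cong_AE, use AE_lborel_singleton[of "0::real"] in eventually_elim)
      case (elim t)
      then show ?case using neg[of t] by (cases "t < 0") (auto split: split_indicator)
    qed
    then show ?case by (simp add: energy_def)
  next
    case (Suc j)
    define r where "r = real (Suc j) * \<tau>"
    have "0 \<le> r" using \<open>0 < \<tau>\<close> by (simp add: r_def)
    have "energy 0 r f \<le> (\<integral>\<^sup>+t. ennreal (exp (- (0 * t)) * (norm (f t))\<^sup>2) * indicator {..real j * \<tau>} t
        + indicator {r - \<tau>..r} t * ennreal ((norm (f t))\<^sup>2) \<partial>lborel)"
      unfolding energy_def
      by (intro nn_integral_mono) (auto simp: r_def algebra_simps split: split_indicator)
    also have "\<dots> = energy 0 (real j * \<tau>) f + (\<integral>\<^sup>+t. indicator {r - \<tau>..r} t * ennreal ((norm (f t))\<^sup>2) \<partial>lborel)"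
      unfolding energy_def by (rule nn_integral_add) measurable
    also have "(\<integral>\<^sup>+t. indicator {r - \<tau>..r} t * ennreal ((norm (f t))\<^sup>2) \<partial>lborel)
        = (\<integral>\<^sup>+s. indicator {r - \<tau>..r} (r + s) * ennreal ((norm (f (r + s)))\<^sup>2) \<partial>lborel)"
      by (subst nn_integral_real_affine[where c=1 and t=r]) simp_all
    also have "\<dots> = (\<integral>\<^sup>+s. indicator {-\<tau>..0} s * ennreal ((norm (f (r + s)))\<^sup>2) \<partial>lborel)"
      by (intro nn_integral_cong) (auto split: split_indicator)
    also have "energy 0 (real j * \<tau>) f + \<dots> < \<infinity>"
      using Suc win[OF \<open>0 \<le> r\<close>] by (subst (asm) square_integrable_on_borel) simp_all
    finally show ?case by (simp add: r_def)
  qed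
  obtain j where "T < real j * \<tau>" using reals_Archimedean3[OF \<open>0 < \<tau>\<close>] by blast
  then have "energy 0 T f \<le> energy 0 (real j * \<tau>) f"
    unfolding energy_def by (intro nn_integral_mono) (auto split: split_indicator)
  with step[of j] show "energy 0 T f < \<infinity>" by (rule le_less_trans[rotated])
qed (use neg in simp_all)

lemma borel_measurable_stack:
  fixes f :: "'x \<Rightarrow> real^'i::finite" and g :: "'x \<Rightarrow> real^'j::finite"
  assumes "f \<in> borel_measurable M" "g \<in> borel_measurable M"
  shows "(\<lambda>t. f t \<sslash> g t) \<in> borel_measurable M"
proof (subst stack_decompose, rule borel_measurable_add)
  show "(\<lambda>t. f t \<sslash> (0 :: real^'j)) \<in> borel_measurable M"
    by (rule measurable_compose[OF assms(1)])
      (intro borel_measurable_continuous_onI linear_continuous_on bounded_linear_stack_left)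
  show "(\<lambda>t. (0 :: real^'i) \<sslash> g t) \<in> borel_measurable M"
    by (rule measurable_compose[OF assms(2)])
      (intro borel_measurable_continuous_onI linear_continuous_on bounded_linear_stack_right)
qed

theorem lemma2:
  fixes K :: nat and \<tau> :: "nat \<Rightarrow> real"
    and N :: "('n::finite, 'm::finite, 'p::finite, 'q::finite, 'r::finite) nds"
    and w :: "real \<Rightarrow> real^'m" and u :: "real \<Rightarrow> real^'p"
    and x :: "real \<Rightarrow> real^'n" and z :: "real \<Rightarrow> real^'q" and y :: "real \<Rightarrow> real^'r"
  assumes "delays K \<tau>"
    and "nds_bounded_measurable K \<tau> N"
    and "W12 {0..} w" and "\<forall>t\<le>0. w t = 0"
    and "W12 {0..} u" and "\<forall>t\<le>0. u t = 0"
    and "\<forall>t\<le>0. x t = 0"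
  shows "satisfies_nds K \<tau> N w u x z y \<longleftrightarrow>
         satisfies_ddf K \<tau> (ddf_of_nds N) w u 0 (\<lambda>i s. 0) x z y
           (nds_memory K \<tau> N w u x) (\<lambda>i. nds_column x w u)"
proof -
  define c where "c = nds_column x w u"
  have K: "1 \<in> {1..K}" and pos: "\<And>i. i \<in> {1..K} \<Longrightarrow> 0 < \<tau> i"
    using assms(1) by (auto simp: delays_def)
  obtain wd where wd: "causal_L2 wd" and w: "w = primitive wd"
    using W12_imp_primitive[OF assms(3,4)] by blast
  obtain ud where ud: "causal_L2 ud" and u: "u = primitive ud"
    using W12_imp_primitive[OF assms(5,6)] by blast
  have L2_w: "causal_L2 w" and L2_u: "causal_L2 u"
    unfolding w u by (intro causal_L2_primitive wd ud)+
  have c_neg: "c t = 0" if "t < 0" for t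
    using that assms(4,6,7) by (simp add: c_def nds_column_def tderiv_def stack_zero)
  have deriv_iff: "(\<forall>T\<ge>0. tderiv x square_integrable_on {0..T}) \<longleftrightarrow> causal_L2 (tderiv x)"
    if "x differentiable_on {0..}"
    by (rule causal_L2_iff_square_integrable[symmetric, OF tderiv_borel_measurable[OF that assms(7)]])
      (simp add: tderiv_def)
  show ?thesis
  proof
    assume nds: "satisfies_nds K \<tau> N w u x z y"
    then have diff: "x differentiable_on {0..}"
      and eq: "\<And>t. 0 \<le> t \<Longrightarrow> tderiv x t \<sslash> z t \<sslash> y t =
        nds_direct N *v (x t \<sslash> w t \<sslash> u t) + nds_memory K \<tau> N w u x t"
      by (auto simp: satisfies_nds_def)
    have L2_dx: "causal_L2 (tderiv x)"
      using nds deriv_iff by (auto simp: satisfies_nds_def)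
    have x: "x = primitive (tderiv x)"
      by (rule primitive_tderiv[OF diff assms(7) L2_dx])
    have L2_x: "causal_L2 x"
      by (subst x) (rule causal_L2_primitive[OF L2_dx])
    have L2_c: "causal_L2 c"
    proof -
      have "causal_L2 (\<lambda>t. x t \<sslash> w t \<sslash> u t \<sslash> tderiv x t)"
        by (intro causal_L2_stack L2_x L2_w L2_u L2_dx)
      then show ?thesis by (simp add: c_def nds_column_def[abs_def])
    qed
    obtain \<Psi> where \<Psi>: "memory_op \<Psi>" "\<And>t. nds_memory K \<tau> N w u x t = \<Psi> c t"
      using nds_memory_op[OF assms(1,2)] L2_c unfolding c_def by metis
    \<comment> \<open>Any index would do: the channel matrices of \<open>ddf_of_nds\<close> are the
      same for all delays.\<close>
    define G where "G = Cri (ddf_of_nds N) 1 \<bbar> Br1i (ddf_of_nds N) 1 \<bbar> Br2i (ddf_of_nds N) 1"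
    define J where "J = Drvi (ddf_of_nds N) 1"
    \<comment> \<open>The candidate derivative of the direct term G (x, w, u). No constant of
      integration appears because x, w and u all vanish at 0.\<close>
    define b where "b t = G *v (tderiv x t \<sslash> wd t \<sslash> ud t)" for t
    have L2_s: "causal_L2 (\<lambda>t. tderiv x t \<sslash> wd t \<sslash> ud t)"
      by (intro causal_L2_stack L2_dx wd ud)
    have L2_b: "causal_L2 b"
      unfolding b_def by (intro causal_L2_linear[OF L2_s] matrix_vector_mul_bounded_linear)
    have prim_b: "primitive b t = G *v (x t \<sslash> w t \<sslash> u t)" for t
    proof -
      have "primitive b t = G *v primitive (\<lambda>t. tderiv x t \<sslash> wd t \<sslash> ud t) t"
        unfolding b_def by (rule primitive_linear[OF L2_s matrix_vector_mul_bounded_linear])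
      also have "primitive (\<lambda>t. tderiv x t \<sslash> wd t \<sslash> ud t) t = x t \<sslash> w t \<sslash> u t"
        by (simp only: primitive_stack L2_dx wd ud causal_L2_stack w u x[symmetric])
      finally show ?thesis .
    qed
    have J: "memory_op (\<lambda>c t. J *v \<Psi> c t)"
      by (rule memory_op_linear[OF \<Psi>(1) matrix_vector_mul_bounded_linear])
    have c_eq: "c t = primitive b t + J *v \<Psi> c t" for t
    \<comment> \<open>The fixed point theorem works on the whole line; before time 0 both sides
      vanish, and from time 0 on the equation is the fourth block row.\<close>
    proof (cases "t < 0")
      case True
      then show ?thesis
        using memory_op_neg[OF J L2_c True] by (simp add: c_neg primitive_neg)
    next
      case False
      with eq have "tderiv x t \<sslash> z t \<sslash> y t = nds_direct N *v (x t \<sslash> w t \<sslash> u t) + nds_memory K \<tau> N w u x t"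
        by simp
      then show ?thesis
        unfolding \<Psi>(2)[symmetric] prim_b
        unfolding ddf_rows_iff_nds_rows[symmetric, where w = w and u = u and i = 1] G_def J_def c_def
        by (simp add: block_simps(1,3,4))
    qed
    obtain h where h: "causal_L2 h" and c: "c = primitive h"
      using memory_op_fixpoint_primitive[OF J L2_c L2_b c_eq] by blast
    show "satisfies_ddf K \<tau> (ddf_of_nds N) w u 0 (\<lambda>i s. 0) x z y
           (nds_memory K \<tau> N w u x) (\<lambda>i. nds_column x w u)"
      unfolding satisfies_ddf_def
    proof (intro conjI ballI allI impI)
      show "bounded_measurable_on (Cvdi (ddf_of_nds N) i) {-\<tau> i..0}" if "i \<in> {1..K}" for i
        using nds_distributed_bounded_measurable[OF assms(2) that] by (simp add: ddf_of_nds_def)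
      show "ddf_initial K \<tau> (ddf_of_nds N) 0 (\<lambda>i s. 0)"
        by (simp add: ddf_initial_def ddf_memory_def W12_zero_window)
      \<comment> \<open>The endpoint s = 0 carries content: it says x'(0) = 0, which follows because
        a primitive vanishes at 0.\<close>
      show "nds_column x w u s = 0" if "s \<in> {-\<tau> i..0}" for i s
        using that by (simp add: c_def[symmetric] c primitive_neg)
      show "W12 {-\<tau> i..0} (\<lambda>s. nds_column x w u (t + s))" for i t
        unfolding c_def[symmetric] c by (rule W12_primitive_window[OF h])
      show "nds_memory K \<tau> N w u x t = ddf_memory K \<tau> (ddf_of_nds N) (\<lambda>i. nds_column x w u) t" for t
        by (simp add: nds_memory_def ddf_memory_def ddf_of_nds_def)
    qed (use diff assms(7) eq in \<open>simp_all only: ddf_rows_iff_nds_rows order_refl\<close>)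
  next
    assume ddf: "satisfies_ddf K \<tau> (ddf_of_nds N) w u 0 (\<lambda>i s. 0) x z y
           (nds_memory K \<tau> N w u x) (\<lambda>i. nds_column x w u)"
    then have diff: "x differentiable_on {0..}"
      and win: "\<And>t. 0 \<le> t \<Longrightarrow> W12 {-\<tau> 1..0} (\<lambda>s. c (t + s))"
      using K by (auto simp: satisfies_ddf_def c_def)
    have rows: "tderiv x t \<sslash> z t \<sslash> y t = nds_direct N *v (x t \<sslash> w t \<sslash> u t) + nds_memory K \<tau> N w u x t"
      if "0 \<le> t" for t
      using ddf that K unfolding satisfies_ddf_def ddf_rows_iff_nds_rows by blast
    \<comment> \<open>The windows of the first channel suffice, since all channels carry the same
      signal; K \<ge> 1 guarantees that it exists.\<close>
    have "causal_L2 c"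
    proof (rule causal_L2_from_windows)
      have m: "x \<in> borel_measurable borel" "tderiv x \<in> borel_measurable borel"
        by (intro causal_borel_measurable tderiv_borel_measurable diff assms(7))+
      have "(\<lambda>t. x t \<sslash> w t \<sslash> u t \<sslash> tderiv x t) \<in> borel_measurable borel"
        by (intro borel_measurable_stack m causal_L2_measurable[OF L2_w] causal_L2_measurable[OF L2_u])
      then show "c \<in> borel_measurable borel"
        by (simp add: c_def nds_column_def[abs_def])
      show "0 < \<tau> 1" by (rule pos[OF K])
      show "(\<lambda>s. c (t + s)) square_integrable_on {-\<tau> 1..0}" if "0 \<le> t" for t
        using win[OF that] by (simp add: W12_def)
    qed (rule c_neg)
    \<comment> \<open>Three projections discard the blocks x, w and u in turn and leave x'.\<close>
    then have "causal_L2 (\<lambda>t. (\<lambda>v. \<chi> j. v $ Inr j) ((\<lambda>v. \<chi> j. v $ Inr j) ((\<lambda>v. \<chi> j. v $ Inr j) (c t))))"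
      by (intro causal_L2_linear[OF _ bounded_linear_lower])
    also have "(\<lambda>t. (\<lambda>v. \<chi> j. v $ Inr j) ((\<lambda>v. \<chi> j. v $ Inr j) ((\<lambda>v. \<chi> j. v $ Inr j) (c t)))) = tderiv x"
      by (simp add: c_def nds_column_def fun_eq_iff)
    finally show "satisfies_nds K \<tau> N w u x z y"
      unfolding satisfies_nds_def using diff deriv_iff[OF diff] assms(7) rows by blast
  qed
qed

end
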